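(* Let $(M,g)$ be a complete, spatial Schwarzschild manifold of dimension $n\ge3$ with positive mass. Let $\Sigma_0$ be the horizon in $(M,g)$ (i.e. the unique closed minimal surface in $(M,g)$). Then the following are true: (i) There exist functions $\lambda$ on $(M,g)$ satisfying $-(\Delta_g\lambda)g+\nabla^2_g\lambda-\lambda\,\mathrm{Ric}(g)=g$. (ii) Let $M_+$, $M_-$ be the two components of $M\setminus\Sigma_0$. Then for any rotationally symmetric sphere $\Sigma_{\zeta_1}$ in $M_+$, there exists a rotationally symmetric sphere $\Sigma_{\zeta_2}$ in $M_-$ such that $g$ is a critical metric on the (closed) domain $\Omega$ bounded by $\Sigma_{\zeta_1}$ and $\Sigma_{\zeta_2}$. (iii) There exists a rotationally symmetric sphere $\Sigma_\theta$ in $M_+$ (or equivalently $M_-$) such that if $\Omega$ is the (closed) domain bounded by $\Sigma_\theta$ and $\Sigma_0$ and if $(\tilde\Omega,\tilde g)$ is the quotient manifold obtained from $(\Omega,g)$ by identifying points on $\Sigma_0$ through the antipodal map on $\Sigma_0$, then $\tilde g$ is a critical metric on $\tilde\Omega$.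
   Context: A metric $g$ on a compact manifold $\Omega$ with smooth boundary is called a critical metric if there is a (smooth) function $\lambda$ on $\Omega$, vanishing on the boundary of $\Omega$, such that $-(\Delta_g\lambda)g+\nabla_g^2\lambda-\lambda\,\mathrm{Ric}(g)=g$ on $\Omega$. The complete spatial Schwarzschild manifold with positive mass is $M=\mathbb{R}^1\times\mathbb{S}^{n-1}$ with $g=ds^2+r(s)^2h$, where $h$ is the standard round metric (sectional curvature $1$) on $\mathbb{S}^{n-1}$ and $r$ is the positive function on $\mathbb{R}^1$ with $r'(0)=0$, $r''=a r^{1-n}$ and $(r')^2+\frac{2a}{n-2}r^{2-n}=1$ for a constant $a>0$ (the mass parameter). Equivalently, on each side of the horizon, $g=\frac{1}{1-\frac{2a}{n-2}r^{2-n}}dr^2+r^2h$. The horizon is $\Sigma_0=\{0\}\times\mathbb{S}^{n-1}$; rotationally symmetric spheres are the slices $\{s\}\times\mathbb{S}^{n-1}$. *)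

theory Defs
  imports "HOL-Analysis.Analysis"
begin

section \<open>Smooth functions\<close>

primrec Ck_on :: "nat \<Rightarrow> 'a::euclidean_space set \<Rightarrow> ('a \<Rightarrow> 'b::real_normed_vector) \<Rightarrow> bool" where
  "Ck_on 0 U f \<longleftrightarrow> continuous_on U f"
| "Ck_on (Suc k) U f \<longleftrightarrow>
     f differentiable_on U \<and> (\<forall>v. Ck_on k U (\<lambda>x. frechet_derivative f (at x) v))"

text \<open>On a set that need not be open, such as a relatively open subset of a half-space, a
  function is smooth if it extends locally to a smooth function on an open set.\<close>

definition smooth_on :: "'a::euclidean_space set \<Rightarrow> ('a \<Rightarrow> 'b::real_normed_vector) \<Rightarrow> bool" where
  "smooth_on D f \<longleftrightarrow>
     (\<forall>x\<in>D. \<exists>U F. open U \<and> x \<in> U \<and> (\<forall>k. Ck_on k U F) \<and> (\<forall>y\<in>U \<inter> D. F y = f y))"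

section \<open>Tensor calculus in a coordinate domain\<close>

text \<open>Throughout, \<open>D\<close> is a coordinate domain and \<open>G x v w\<close> is the coordinate expression of the
  metric at \<open>x \<in> D\<close>, applied to tangent vectors \<open>v\<close>, \<open>w\<close>.  The derivative is taken within
  \<open>D\<close>, so that it also makes sense at boundary points (where it is the one-sided derivative).\<close>

definition dder ::
    "'a::euclidean_space set \<Rightarrow> ('a \<Rightarrow> 'b::real_normed_vector) \<Rightarrow> 'a \<Rightarrow> 'a \<Rightarrow> 'b" where
  "dder D f x v = frechet_derivative f (at x within D) v"

text \<open>The vector dual to the linear form \<open>l\<close> (raising an index with \<open>G x\<close>).\<close>

definition sharp ::
    "('a::euclidean_space \<Rightarrow> 'a \<Rightarrow> 'a \<Rightarrow> real) \<Rightarrow> 'a \<Rightarrow> ('a \<Rightarrow> real) \<Rightarrow> 'a" where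
  "sharp G x l = (THE z. \<forall>e. G x z e = l e)"

text \<open>\<open>christoffel D G x v w\<close> is the vector with components
  \<open>\<Gamma>\<^sup>k\<^sub>i\<^sub>j v\<^sup>i w\<^sup>j\<close>.\<close>

definition christoffel ::
    "'a::euclidean_space set \<Rightarrow> ('a \<Rightarrow> 'a \<Rightarrow> 'a \<Rightarrow> real) \<Rightarrow> 'a \<Rightarrow> 'a \<Rightarrow> 'a \<Rightarrow> 'a" where
  "christoffel D G x v w = sharp G x (\<lambda>e.
     (dder D (\<lambda>y. G y w e) x v + dder D (\<lambda>y. G y v e) x w - dder D (\<lambda>y. G y v w) x e) / 2)"

text \<open>\<open>R(u,v)w = \<nabla>\<^sub>u\<nabla>\<^sub>v w - \<nabla>\<^sub>v\<nabla>\<^sub>u w\<close> for constant coordinate vector fields \<open>u\<close>, \<open>v\<close>, \<open>w\<close>;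
  with this sign the round sphere has \<open>R(u,v)w = \<langle>v,w\<rangle>u - \<langle>u,w\<rangle>v\<close>.\<close>

definition riemann ::
    "'a::euclidean_space set \<Rightarrow> ('a \<Rightarrow> 'a \<Rightarrow> 'a \<Rightarrow> real) \<Rightarrow> 'a \<Rightarrow> 'a \<Rightarrow> 'a \<Rightarrow> 'a \<Rightarrow> 'a" where
  "riemann D G x u v w =
     dder D (\<lambda>y. christoffel D G y v w) x u - dder D (\<lambda>y. christoffel D G y u w) x v
     + christoffel D G x u (christoffel D G x v w)
     - christoffel D G x v (christoffel D G x u w)"

text \<open>The trace of \<open>u \<mapsto> R(u,v)w\<close>.\<close>

definition ricci ::
    "'a::euclidean_space set \<Rightarrow> ('a \<Rightarrow> 'a \<Rightarrow> 'a \<Rightarrow> real) \<Rightarrow> 'a \<Rightarrow> 'a \<Rightarrow> 'a \<Rightarrow> real" where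
  "ricci D G x v w = (\<Sum>b\<in>Basis. riemann D G x b v w \<bullet> b)"

definition hessian ::
    "'a::euclidean_space set \<Rightarrow> ('a \<Rightarrow> 'a \<Rightarrow> 'a \<Rightarrow> real) \<Rightarrow> ('a \<Rightarrow> real) \<Rightarrow> 'a \<Rightarrow> 'a \<Rightarrow> 'a \<Rightarrow> real"
  where
  "hessian D G f x v w =
     dder D (\<lambda>y. dder D f y w) x v - dder D f x (christoffel D G x v w)"

text \<open>The trace of the Hessian with respect to the metric.\<close>

definition laplacian ::
    "'a::euclidean_space set \<Rightarrow> ('a \<Rightarrow> 'a \<Rightarrow> 'a \<Rightarrow> real) \<Rightarrow> ('a \<Rightarrow> real) \<Rightarrow> 'a \<Rightarrow> real" where
  "laplacian D G f x = (\<Sum>b\<in>Basis. sharp G x (hessian D G f x b) \<bullet> b)"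

section \<open>Riemannian manifolds with boundary\<close>

text \<open>A chart is given by its parametrization \<open>cpar\<close>, defined on a subset \<open>cdom\<close> of a Euclidean
  space of the dimension of the manifold, together with the coordinate expression \<open>cmet\<close>
  of the metric.\<close>

record ('a, 'p) rchart =
  cdom :: "'a set"
  cpar :: "'a \<Rightarrow> 'p"
  cmet :: "'a \<Rightarrow> 'a \<Rightarrow> 'a \<Rightarrow> real"

record ('a, 'p) rmanifold =
  mtop :: "'p topology"
  atlas :: "('a, 'p) rchart set"

text \<open>Near each of its points, \<open>D\<close> is relatively open in a closed half-space.  This includes
  the interior points, for which the half-space can be chosen to contain a neighbourhood.\<close>

definition half_space_like :: "'a::euclidean_space set \<Rightarrow> bool" where
  "half_space_like D \<longleftrightarrow>
     (\<forall>x\<in>D. \<exists>U u c. open U \<and> x \<in> U \<and> u \<noteq> 0 \<and> D \<inter> U = {y\<in>U. u \<bullet> y \<le> c})"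

definition overlap :: "('a, 'p) rchart \<Rightarrow> ('a, 'p) rchart \<Rightarrow> 'a set" where
  "overlap c d = {x \<in> cdom c. cpar c x \<in> cpar d ` cdom d}"

definition transition :: "('a, 'p) rchart \<Rightarrow> ('a, 'p) rchart \<Rightarrow> 'a \<Rightarrow> 'a" where
  "transition c d x = inv_into (cdom d) (cpar d) (cpar c x)"

definition riemannian_chart ::
    "'p topology \<Rightarrow> ('a::euclidean_space, 'p) rchart \<Rightarrow> bool" where
  "riemannian_chart T c \<longleftrightarrow>
     half_space_like (cdom c) \<and>
     embedding_map (top_of_set (cdom c)) T (cpar c) \<and>
     openin T (cpar c ` cdom c) \<and>
     (\<forall>v w. smooth_on (cdom c) (\<lambda>x. cmet c x v w)) \<and>
     (\<forall>x\<in>cdom c. bilinear (cmet c x) \<and> (\<forall>v w. cmet c x v w = cmet c x w v) \<and>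
        (\<forall>v. v \<noteq> 0 \<longrightarrow> cmet c x v v > 0))"

definition compatible_charts ::
    "('a::euclidean_space, 'p) rchart \<Rightarrow> ('a, 'p) rchart \<Rightarrow> bool" where
  "compatible_charts c d \<longleftrightarrow>
     smooth_on (overlap c d) (transition c d) \<and>
     (\<forall>x\<in>overlap c d. \<forall>v w.
        cmet c x v w =
        cmet d (transition c d x)
          (dder (overlap c d) (transition c d) x v) (dder (overlap c d) (transition c d) x w))"

definition riemannian_manifold :: "('a::euclidean_space, 'p) rmanifold \<Rightarrow> bool" where
  "riemannian_manifold X \<longleftrightarrow>
     Hausdorff_space (mtop X) \<and> second_countable (mtop X) \<and>
     (\<Union>c\<in>atlas X. cpar c ` cdom c) = topspace (mtop X) \<and>
     (\<forall>c\<in>atlas X. riemannian_chart (mtop X) c) \<and>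
     (\<forall>c\<in>atlas X. \<forall>d\<in>atlas X. compatible_charts c d)"

definition manifold_boundary :: "('a::euclidean_space, 'p) rmanifold \<Rightarrow> 'p set" where
  "manifold_boundary X = (\<Union>c\<in>atlas X. cpar c ` (cdom c - interior (cdom c)))"

definition smooth_function :: "('a::euclidean_space, 'p) rmanifold \<Rightarrow> ('p \<Rightarrow> real) \<Rightarrow> bool" where
  "smooth_function X f \<longleftrightarrow> (\<forall>c\<in>atlas X. smooth_on (cdom c) (f \<circ> cpar c))"

text \<open>\<open>-(\<Delta>f) g + \<nabla>\<^sup>2f - f Ric(g) = g\<close>, read in every chart of the atlas.\<close>

definition critical_equation :: "('a::euclidean_space, 'p) rmanifold \<Rightarrow> ('p \<Rightarrow> real) \<Rightarrow> bool" where
  "critical_equation X f \<longleftrightarrow>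
     (\<forall>c\<in>atlas X. \<forall>x\<in>cdom c. \<forall>v w.
        - laplacian (cdom c) (cmet c) (f \<circ> cpar c) x * cmet c x v w
        + hessian (cdom c) (cmet c) (f \<circ> cpar c) x v w
        - f (cpar c x) * ricci (cdom c) (cmet c) x v w
        = cmet c x v w)"

definition critical_metric :: "('a::euclidean_space, 'p) rmanifold \<Rightarrow> bool" where
  "critical_metric X \<longleftrightarrow>
     riemannian_manifold X \<and> compact_space (mtop X) \<and>
     (\<exists>f. smooth_function X f \<and> (\<forall>p\<in>manifold_boundary X. f p = 0) \<and> critical_equation X f)"

text \<open>The closed domain \<open>\<Omega>\<close> of \<open>X\<close>, with the induced metric.\<close>

definition subdomain :: "('a, 'p) rmanifold \<Rightarrow> 'p set \<Rightarrow> ('a, 'p) rmanifold" where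
  "subdomain X \<Omega> =
     \<lparr>mtop = subtopology (mtop X) \<Omega>,
      atlas = (\<lambda>c. c\<lparr>cdom := {x \<in> cdom c. cpar c x \<in> \<Omega>}\<rparr>) ` atlas X\<rparr>"

section \<open>The spatial Schwarzschild manifold\<close>

text \<open>The dimension is \<open>n = DIM('a)\<close> and the sphere is the unit sphere of \<open>'a\<close>.\<close>

definition schwarzschild_space :: "(real \<times> 'a::euclidean_space) set" where
  "schwarzschild_space = UNIV \<times> sphere 0 1"

definition slice :: "real \<Rightarrow> (real \<times> 'a::euclidean_space) set" where
  "slice \<zeta> = {\<zeta>} \<times> sphere 0 1"

abbreviation horizon :: "(real \<times> 'a::euclidean_space) set" where
  "horizon \<equiv> slice 0"

definition domain_between :: "real \<Rightarrow> real \<Rightarrow> (real \<times> 'a::euclidean_space) set" where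
  "domain_between \<zeta>1 \<zeta>2 = closed_segment \<zeta>1 \<zeta>2 \<times> sphere 0 1"

definition schwarzschild_profile :: "nat \<Rightarrow> real \<Rightarrow> (real \<Rightarrow> real) \<Rightarrow> bool" where
  "schwarzschild_profile n a r \<longleftrightarrow>
     a > 0 \<and> deriv r 0 = 0 \<and>
     (\<forall>s. r s > 0 \<and> r differentiable at s \<and>
        (deriv r has_real_derivative a * r s powr (1 - real n)) (at s) \<and>
        (deriv r s)\<^sup>2 + 2 * a / (real n - 2) * r s powr (2 - real n) = 1)"

text \<open>The metric \<open>ds\<^sup>2 + r(s)\<^sup>2 h\<close> on tangent vectors at \<open>p\<close>, the round metric \<open>h\<close> being
  the restriction of the Euclidean inner product to the tangent spaces of the unit sphere.\<close>

definition warped_metric ::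
    "(real \<Rightarrow> real) \<Rightarrow> real \<times> 'a \<Rightarrow> real \<times> 'a::euclidean_space \<Rightarrow> real \<times> 'a \<Rightarrow> real" where
  "warped_metric r p V W = fst V * fst W + (r (fst p))\<^sup>2 * (snd V \<bullet> snd W)"

text \<open>For a unit vector \<open>u\<close>, split \<open>x = s u + y\<close> with \<open>y\<close> orthogonal to \<open>u\<close>.  The
  parametrization sends \<open>x\<close> to \<open>(s, \<omega>)\<close>, where \<open>\<omega> \<noteq> u\<close> is the point of the unit sphere
  whose stereographic projection from the pole \<open>u\<close> is \<open>y\<close>.\<close>

definition stereo_par :: "'a::euclidean_space \<Rightarrow> 'a \<Rightarrow> real \<times> 'a" where
  "stereo_par u x =
     (let s = x \<bullet> u; y = x - s *\<^sub>R u
      in (s, (1 / (1 + (norm y)\<^sup>2)) *\<^sub>R (2 *\<^sub>R y + ((norm y)\<^sup>2 - 1) *\<^sub>R u)))"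

definition stereo_chart ::
    "(real \<Rightarrow> real) \<Rightarrow> 'a::euclidean_space \<Rightarrow> ('a, real \<times> 'a) rchart" where
  "stereo_chart r u =
     \<lparr>cdom = UNIV, cpar = stereo_par u,
      cmet = (\<lambda>x v w. warped_metric r (stereo_par u x)
        (frechet_derivative (stereo_par u) (at x) v)
        (frechet_derivative (stereo_par u) (at x) w))\<rparr>"

definition schwarzschild ::
    "(real \<Rightarrow> real) \<Rightarrow> ('a::euclidean_space, real \<times> 'a) rmanifold" where
  "schwarzschild r =
     \<lparr>mtop = top_of_set schwarzschild_space, atlas = stereo_chart r ` sphere 0 1\<rparr>"

section \<open>Identifying antipodal points of the horizon\<close>

definition antipodal_class :: "real \<times> 'a::euclidean_space \<Rightarrow> (real \<times> 'a) set" where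
  "antipodal_class p = (if fst p = 0 then {p, (0, - snd p)} else {p})"

definition quotient_topology :: "'p topology \<Rightarrow> ('p \<Rightarrow> 'q) \<Rightarrow> 'q topology" where
  "quotient_topology T q =
     topology (\<lambda>U. U \<subseteq> q ` topspace T \<and> openin T {x \<in> topspace T. q x \<in> U})"

lemma openin_quotient_topology:
  "openin (quotient_topology T q) U \<longleftrightarrow>
     U \<subseteq> q ` topspace T \<and> openin T {x \<in> topspace T. q x \<in> U}"
proof -
  have "istopology (\<lambda>U. U \<subseteq> q ` topspace T \<and> openin T {x \<in> topspace T. q x \<in> U})"
    unfolding istopology_def
  proof (intro conjI allI impI)
    fix S U
    assume "S \<subseteq> q ` topspace T \<and> openin T {x \<in> topspace T. q x \<in> S}"
      and "U \<subseteq> q ` topspace T \<and> openin T {x \<in> topspace T. q x \<in> U}"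
    moreover have "{x \<in> topspace T. q x \<in> S \<inter> U} =
        {x \<in> topspace T. q x \<in> S} \<inter> {x \<in> topspace T. q x \<in> U}"
      by blast
    ultimately show "openin T {x \<in> topspace T. q x \<in> S \<inter> U}" "S \<inter> U \<subseteq> q ` topspace T"
      by auto
  next
    fix \<K>
    assume *: "\<forall>K\<in>\<K>. K \<subseteq> q ` topspace T \<and> openin T {x \<in> topspace T. q x \<in> K}"
    then show "\<Union>\<K> \<subseteq> q ` topspace T"
      by blast
    have "{x \<in> topspace T. q x \<in> \<Union>\<K>} = (\<Union>K\<in>\<K>. {x \<in> topspace T. q x \<in> K})"
      by blast
    then show "openin T {x \<in> topspace T. q x \<in> \<Union>\<K>}"
      using * by (metis (no_types, lifting) openin_clauses(3) imageE)
  qed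
  then show ?thesis
    by (simp add: quotient_topology_def)
qed

lemma topspace_quotient_topology: "topspace (quotient_topology T q) = q ` topspace T"
proof
  show "topspace (quotient_topology T q) \<subseteq> q ` topspace T"
    using openin_quotient_topology openin_topspace by metis
  have "{x \<in> topspace T. q x \<in> q ` topspace T} = topspace T"
    by blast
  then have "openin (quotient_topology T q) (q ` topspace T)"
    by (simp add: openin_quotient_topology)
  then show "q ` topspace T \<subseteq> topspace (quotient_topology T q)"
    by (rule openin_subset)
qed

lemma quotient_map_quotient_topology: "quotient_map T (quotient_topology T q) q"
  by (auto simp: quotient_map_def topspace_quotient_topology openin_quotient_topology)

text \<open>Let \<open>\<Omega>\<close> be a domain bounded by the horizon and another slice.  The quotient of \<open>\<Omega>\<close> is
  parametrized by the points \<open>p\<close> of the symmetric domain \<open>\<Omega> \<union> -\<Omega>\<close>: a point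
  \<open>p \<in> \<Omega>\<close> represents its own class, and a point \<open>p = (s, \<omega>)\<close> on the other side of the
  horizon represents the class of \<open>-p = (-s, -\<omega>) \<in> \<Omega>\<close>.  Thus crossing the horizon at
  \<open>(0, \<omega>)\<close> means to re-enter \<open>\<Omega>\<close> at \<open>(0, -\<omega>)\<close>, with \<open>s\<close> as the common normal
  coordinate.  Restricting the stereographic chart with pole \<open>u\<close> to the open hemisphere around
  \<open>-u\<close> makes this injective.  The metric of the chart is that of the Schwarzschild
  manifold also for \<open>s\<close> on the other side, because \<open>p \<mapsto> -p\<close> is an isometry (\<open>r\<close> is even).\<close>

definition quotient_chart ::
    "(real \<times> 'a) set \<Rightarrow> (real \<Rightarrow> real) \<Rightarrow> 'a::euclidean_space \<Rightarrow> ('a, (real \<times> 'a) set) rchart" where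
  "quotient_chart \<Omega> r u =
     \<lparr>cdom = {x. stereo_par u x \<in> \<Omega> \<union> uminus ` \<Omega> \<and> snd (stereo_par u x) \<bullet> u < 0},
      cpar = (\<lambda>x. let p = stereo_par u x in antipodal_class (if p \<in> \<Omega> then p else - p)),
      cmet = cmet (stereo_chart r u)\<rparr>"

definition antipodal_quotient ::
    "(real \<Rightarrow> real) \<Rightarrow> (real \<times> 'a::euclidean_space) set \<Rightarrow> ('a, (real \<times> 'a) set) rmanifold" where
  "antipodal_quotient r \<Omega> =
     \<lparr>mtop = quotient_topology (top_of_set \<Omega>) antipodal_class,
      atlas = quotient_chart \<Omega> r ` sphere 0 1\<rparr>"

end

theory Submission
  imports Defs
begin

text \<open>For a radial function \<open>\<lambda>(s)\<close> the critical equation on \<open>ds\<^sup>2 + r\<^sup>2 h\<close> reduces to the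
  first-order equation \<open>r' \<lambda>' - r'' \<lambda> = - r / (n - 1)\<close> in the radial direction;
  differentiated, it gives \<open>\<lambda>'' = - 1 / (n - 1) - (n - 1) (r'' / r) \<lambda>\<close>, and the two together imply
  the equation in the spherical directions.
  The solutions form a one-parameter family, two of them differing by a multiple of \<open>r'\<close>, which
  vanishes only at the horizon; so a zero can be prescribed at any \<open>\<zeta>1 \<noteq> 0\<close>.  All solutions are
  positive at the horizon, and strictly concave, with \<open>\<lambda>'' \<le> - 1 / (n - 1)\<close>, where positive;
  hence each has a zero on either side of the horizon.  Since \<open>r\<close> is even, one of the solutions is
  even and descends to the antipodal quotient.

  The curvature is computed in stereographic coordinates \<open>x = s u + y\<close>, where the metric is
  \<open>ds\<^sup>2 + \<phi> |dy|\<^sup>2\<close> with \<open>\<phi> = (2 r / (1 + |y|\<^sup>2))\<^sup>2\<close>.\<close>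

section \<open>Differentiability of finite order\<close>

text \<open>The first-order equation is singular at the horizon, where its leading coefficient r'
  vanishes, so an existence theorem for regular equations does not carry solutions across it;
  solutions in closed form settle smoothness on the whole line. At the horizon the equation itself
  reads r'' \<lambda> = r / (n - 1), which forces positivity whatever the parameter. The passage to
  the spherical directions rests on the first integral of the profile, that is, on vanishing scalar
  curvature. Smoothness and evenness of \<open>r\<close> are not part of
  \<open>schwarzschild_profile\<close> and have to be derived from its equations.

  On the side of the manifolds, the equation must hold in every chart up to the boundary, where
  derivatives are one-sided. Every chart metric here is the restriction of one formula valid on the
  full coordinate space, and so is every potential. The tensors are therefore computed once, for an
  arbitrary half-space-like domain, and serve the whole manifold, the closed domain and the
  antipodal quotient alike.\<close>

lemma Ck_on_cong:
  assumes "open U" "\<And>x. x \<in> U \<Longrightarrow> f x = g x" "Ck_on k U f"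
  shows "Ck_on k U g"
  using assms(2,3)
proof (induction k arbitrary: f g)
  case 0
  then show ?case by (simp cong: continuous_on_cong)
next
  case (Suc k)
  have fr: "frechet_derivative f (at x) = frechet_derivative g (at x)" if "x \<in> U" for x
    using Suc.prems(1) \<open>open U\<close> that
    by (intro frechet_derivative_transform_within_open[of f x U g])
       (use Suc.prems(2) in \<open>auto simp: differentiable_on_eq_differentiable_at\<close>)
  have "g differentiable_on U"
    using Suc.prems by (metis Ck_on.simps(2) differentiable_on_def differentiable_transform_within zero_less_one)
  moreover have "Ck_on k U (\<lambda>x. frechet_derivative g (at x) v)" for v
    by (rule Suc.IH[of "\<lambda>x. frechet_derivative f (at x) v"]) (use fr Suc.prems in auto)
  ultimately show ?case by simp
qed

text \<open>\<open>Ck_on\<close> refers to derivatives through \<open>frechet_derivative\<close>;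
  this rule admits an explicit derivative instead. The closure rules are inductions on the order,
  fed here with the product, quotient or chain rule.\<close>

lemma Ck_on_SucI:
  assumes "open U" "\<And>x. x \<in> U \<Longrightarrow> (f has_derivative f' x) (at x)"
    and "\<And>v. Ck_on k U (\<lambda>x. f' x v)"
  shows "Ck_on (Suc k) U f"
proof -
  have "f differentiable_on U"
    using assms(1,2) by (auto simp: differentiable_on_eq_differentiable_at differentiable_def)
  moreover have "Ck_on k U (\<lambda>x. frechet_derivative f (at x) v)" for v
    by (rule Ck_on_cong[OF assms(1) _ assms(3)[of v]])
       (use assms(2) frechet_derivative_at in fastforce)
  ultimately show ?thesis by simp
qed

lemma Ck_on_SucD:
  assumes "open U" "Ck_on (Suc k) U f"
  shows "x \<in> U \<Longrightarrow> (f has_derivative frechet_derivative f (at x)) (at x)"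
    and "Ck_on k U (\<lambda>x. frechet_derivative f (at x) v)"
    and "Ck_on k U f"
proof -
  show "x \<in> U \<Longrightarrow> (f has_derivative frechet_derivative f (at x)) (at x)"
    using assms by (simp add: differentiable_on_eq_differentiable_at frechet_derivative_works)
  show "Ck_on k U (\<lambda>x. frechet_derivative f (at x) v)" 
    using assms by simp
  show "Ck_on k U f"
    using assms(2)
  proof (induction k arbitrary: f)
    case 0
    then show ?case by (simp add: differentiable_imp_continuous_on)
  next
    case (Suc k)
    then show ?case by (metis Ck_on.simps(2))
  qed
qed

lemma Ck_on_subset: "Ck_on k U f \<Longrightarrow> W \<subseteq> U \<Longrightarrow> Ck_on k W f"
  by (induction k arbitrary: f) (auto intro: continuous_on_subset differentiable_on_subset)

lemma Ck_on_const: "open U \<Longrightarrow> Ck_on k U (\<lambda>x. c)"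
proof (induction k arbitrary: c)
  case 0
  then show ?case by simp
next
  case (Suc k)
  then show ?case by (intro Ck_on_SucI[where f'="\<lambda>x v. 0"]) auto
qed

lemma Ck_on_bounded_linear:
  assumes "open U" "bounded_linear f"
  shows "Ck_on k U f"
proof (cases k)
  case 0
  then show ?thesis using assms by (simp add: linear_continuous_on)
next
  case (Suc m)
  show ?thesis
    unfolding Suc
    by (rule Ck_on_SucI[where f'="\<lambda>x. f"])
       (use assms in \<open>auto intro: bounded_linear_imp_has_derivative Ck_on_const\<close>)
qed

lemma Ck_on_add:
  assumes "open U" "Ck_on k U f" "Ck_on k U g"
  shows "Ck_on k U (\<lambda>x. f x + g x)"
  using assms(2,3)
proof (induction k arbitrary: f g)
  case 0
  then show ?case by (auto intro: continuous_intros)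
next
  case (Suc k)
  note D = Ck_on_SucD[OF assms(1) Suc.prems(1)] Ck_on_SucD[OF assms(1) Suc.prems(2)]
  show ?case
    by (rule Ck_on_SucI[OF assms(1) has_derivative_add[OF D(1) D(4)] Suc.IH[OF D(2) D(5)]])
qed

lemma (in bounded_bilinear) Ck_on_prod:
  assumes "open U" "Ck_on k U f" "Ck_on k U g"
  shows "Ck_on k U (\<lambda>x. prod (f x) (g x))"
  using assms(2,3)
proof (induction k arbitrary: f g)
  case 0
  then show ?case by (auto intro: continuous_on)
next
  case (Suc k)
  note D = Ck_on_SucD[OF assms(1) Suc.prems(1)] Ck_on_SucD[OF assms(1) Suc.prems(2)]
  show ?case
    by (rule Ck_on_SucI[OF assms(1) FDERIV[OF D(1) D(4)]
          Ck_on_add[OF assms(1) Suc.IH[OF D(3) D(5)] Suc.IH[OF D(2) D(6)]]])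
qed

lemmas Ck_on_mult = bounded_bilinear.Ck_on_prod[OF bounded_bilinear_mult]
lemmas Ck_on_scaleR = bounded_bilinear.Ck_on_prod[OF bounded_bilinear_scaleR]
lemmas Ck_on_inner = bounded_bilinear.Ck_on_prod[OF bounded_bilinear_inner]

lemma Ck_on_minus:
  assumes "open U" "Ck_on k U f"
  shows "Ck_on k U (\<lambda>x. - f x)"
  using Ck_on_scaleR[OF assms(1) Ck_on_const[OF assms(1), of k "-1"] assms(2)] by simp

lemma Ck_on_diff:
  assumes "open U" "Ck_on k U f" "Ck_on k U g"
  shows "Ck_on k U (\<lambda>x. f x - g x)"
  using Ck_on_add[OF assms(1,2) Ck_on_minus[OF assms(1,3)]] by simp

lemma Ck_on_power:
  fixes f :: "_ \<Rightarrow> real"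
  assumes "open U" "Ck_on k U f"
  shows "Ck_on k U (\<lambda>x. f x ^ m)"
  by (induction m) (auto intro: Ck_on_mult Ck_on_const assms)

lemma Ck_on_inverse:
  fixes f :: "_ \<Rightarrow> real"
  assumes "open U" "\<And>x. x \<in> U \<Longrightarrow> f x \<noteq> 0" "Ck_on k U f"
  shows "Ck_on k U (\<lambda>x. inverse (f x))"
  using assms(2,3)
proof (induction k arbitrary: f)
  case 0
  then show ?case by (auto intro: continuous_on_inverse)
next
  case (Suc k)
  note D = Ck_on_SucD[OF assms(1) Suc.prems(2)]
  show ?case
    by (rule Ck_on_SucI[OF assms(1) Deriv.has_derivative_inverse[OF _ D(1)]])
       (use Suc.prems D(2,3) in \<open>auto intro!: Ck_on_minus Ck_on_mult Suc.IH assms\<close>)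
qed

lemma Ck_on_divide:
  fixes f g :: "_ \<Rightarrow> real"
  assumes "open U" "\<And>x. x \<in> U \<Longrightarrow> g x \<noteq> 0" "Ck_on k U f" "Ck_on k U g"
  shows "Ck_on k U (\<lambda>x. f x / g x)"
  unfolding divide_inverse by (intro Ck_on_mult Ck_on_inverse assms)

lemmas Ck_on_intros = Ck_on_const Ck_on_add Ck_on_diff Ck_on_minus Ck_on_mult Ck_on_scaleR
  Ck_on_inner Ck_on_power Ck_on_inverse Ck_on_divide
  Ck_on_bounded_linear[OF _ bounded_linear_ident]

lemma Ck_on_real_Suc:
  fixes h :: "real \<Rightarrow> real"
  assumes "open U" "\<And>t. t \<in> U \<Longrightarrow> (h has_real_derivative h' t) (at t)" "Ck_on k U h'"
  shows "Ck_on (Suc k) U h"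
  by (rule Ck_on_SucI[where f'="\<lambda>t v. h' t * v"])
     (use assms in \<open>auto simp: has_field_derivative_def intro: Ck_on_intros\<close>)

text \<open>The chain rule replaces the outer function by its derivative and keeps \<open>f\<close>,
  so the induction generalises over \<open>h\<close> only.\<close>

lemma Ck_on_compose_real:
  fixes h :: "real \<Rightarrow> real" and f :: "_ \<Rightarrow> real"
  assumes "open U" "Ck_on k UNIV h" "Ck_on k U f"
  shows "Ck_on k U (\<lambda>x. h (f x))"
  using assms(2,3)
proof (induction k arbitrary: h)
  case 0
  then show ?case by (auto intro: continuous_on_compose2[of UNIV h U f])
next
  case (Suc k)
  define h' where "h' t = frechet_derivative h (at t) 1" for t
  note D = Ck_on_SucD[OF open_UNIV Suc.prems(1)] Ck_on_SucD[OF assms(1) Suc.prems(2)]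
  have hd: "(h has_derivative (\<lambda>v. v * h' t)) (at t)" for t
  proof -
    have "frechet_derivative h (at t) v = v * h' t" for v
      using linear_scale[OF has_derivative_linear[OF D(1)[of t]], of v 1] by (simp add: h'_def)
    then have "frechet_derivative h (at t) = (\<lambda>v. v * h' t)" by blast
    then show ?thesis using D(1)[of t] by simp
  qed
  show ?case
  proof (rule Ck_on_SucI[OF assms(1)])
    show "((\<lambda>x. h (f x)) has_derivative (\<lambda>v. frechet_derivative f (at x) v * h' (f x))) (at x)" if "x \<in> U" for x
      using has_derivative_compose[OF D(4)[OF that] hd] .
    show "Ck_on k U (\<lambda>x. frechet_derivative f (at x) v * h' (f x))" for v
      by (rule Ck_on_mult[OF assms(1) D(5) Suc.IH[OF _ D(6)]]) (simp add: h'_def D(2))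
  qed
qed

lemma smooth_onI:
  assumes "open U" "D \<subseteq> U" "\<And>k. Ck_on k U F" "\<And>y. y \<in> D \<Longrightarrow> F y = f y"
  shows "smooth_on D f"
  unfolding smooth_on_def using assms by blast

section \<open>Derivatives on half-space-like domains\<close>

lemma half_space_like_open:
  fixes W :: "'a::euclidean_space set"
  assumes "open W"
  shows "half_space_like W"
  unfolding half_space_like_def
proof
  fix x assume x: "x \<in> W"
  obtain b :: 'a where "b \<in> Basis" using nonempty_Basis by blast
  then have b: "b \<noteq> 0" by (rule nonzero_Basis)
  \<comment> \<open>The half-space imposes nothing: \<open>U\<close> is cut down to where its
    inequality holds anyway.\<close>
  show "\<exists>U u c. open U \<and> x \<in> U \<and> u \<noteq> 0 \<and> W \<inter> U = {y \<in> U. u \<bullet> y \<le> c}"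
    by (rule exI[of _ "W \<inter> {y. b \<bullet> y < b \<bullet> x + 1}"], rule exI[of _ b], rule exI[of _ "b \<bullet> x + 1"])
       (use assms x b in \<open>auto intro!: open_Int open_halfspace_lt\<close>)
qed

text \<open>Since \<alpha> < \<beta>, no point lies on both faces: below the upper face only the
  lower one matters locally, and on the upper face only that one.\<close>

lemma half_space_like_slab:
  fixes W :: "'a::euclidean_space set"
  assumes "open W" "u \<noteq> 0" "\<alpha> < \<beta>"
  shows "half_space_like {x\<in>W. \<alpha> \<le> x \<bullet> u \<and> x \<bullet> u \<le> \<beta>}" (is "half_space_like ?D")
  unfolding half_space_like_def
proof
  fix x assume x: "x \<in> ?D"
  show "\<exists>U u c. open U \<and> x \<in> U \<and> u \<noteq> 0 \<and> ?D \<inter> U = {y \<in> U. u \<bullet> y \<le> c}"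
  proof (cases "x \<bullet> u < \<beta>")
    case True
    show ?thesis
      by (rule exI[of _ "W \<inter> {y. u \<bullet> y < \<beta>}"], rule exI[of _ "- u"], rule exI[of _ "- \<alpha>"])
         (use assms x True in \<open>auto intro!: open_Int open_halfspace_lt simp: inner_commute[of _ u]\<close>)
  next
    case False
    show ?thesis
      by (rule exI[of _ "W \<inter> {y. u \<bullet> y > \<alpha>}"], rule exI[of _ "u"], rule exI[of _ "\<beta>"])
         (use assms x False in \<open>auto intro!: open_Int open_halfspace_gt simp: inner_commute[of _ u]\<close>)
  qed
qed

lemma half_space_like_Int_open:
  fixes W :: "'a::euclidean_space set"
  assumes "half_space_like D" "open W"
  shows "half_space_like (D \<inter> W)"
  unfolding half_space_like_def
proof
  fix x assume x: "x \<in> D \<inter> W"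
  then obtain U u c where U: "open U" "x \<in> U" "u \<noteq> 0" "D \<inter> U = {y\<in>U. u \<bullet> y \<le> c}"
    using assms(1)[unfolded half_space_like_def] by (metis IntD1)
  have "D \<inter> W \<inter> (U \<inter> W) = {y \<in> U \<inter> W. u \<bullet> y \<le> c}"
    using U(4) by blast
  then show "\<exists>U u c. open U \<and> x \<in> U \<and> u \<noteq> 0 \<and> D \<inter> W \<inter> U = {y \<in> U. u \<bullet> y \<le> c}"
    using U(1-3) x assms(2) by (metis IntD2 IntI open_Int)
qed

text \<open>From any point of a half-space one can move a little along each basis vector, in at
  least one of its two senses, without leaving the half-space. This determines the derivative, at
  boundary points too.\<close>

lemma frechet_derivative_within_half_space_like:
  fixes D :: "'a::euclidean_space set"
  assumes "half_space_like D" "x \<in> D" "(f has_derivative f') (at x within D)"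
  shows "frechet_derivative f (at x within D) = f'"
proof -
  obtain U u c where U: "open U" "x \<in> U" "D \<inter> U = {y\<in>U. u \<bullet> y \<le> c}"
    using assms(1)[unfolded half_space_like_def] assms(2) by metis
  have xc: "u \<bullet> x \<le> c" using U assms(2) by blast
  show ?thesis
  proof (rule frechet_derivative_unique_within[OF _ assms(3)])
    show "(f has_derivative frechet_derivative f (at x within D)) (at x within D)"
      using assms(3) differentiable_def frechet_derivative_works by blast
    fix i :: 'a and e :: real
    assume i: "i \<in> Basis" and e: "e > 0"
    obtain d where d: "d > 0" "ball x d \<subseteq> U" using U openE by blast
    \<comment> \<open>The sign keeps \<open>u \<bullet> y\<close> from increasing along the segment,
      so the half-space is not left.\<close>
    define t where "t = (if u \<bullet> i \<le> 0 then 1 else - 1) * min d e / 2"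
    have t: "0 < \<bar>t\<bar>" "\<bar>t\<bar> < e" "\<bar>t\<bar> < d" "t * (u \<bullet> i) \<le> 0"
      using d e by (auto simp: t_def abs_mult min_def mult_le_0_iff)
    have "dist x (x + t *\<^sub>R i) < d" using t(3) i by (simp add: dist_norm)
    then have "x + t *\<^sub>R i \<in> U" using d(2) by auto
    moreover have "u \<bullet> (x + t *\<^sub>R i) \<le> c" using t(4) xc by (simp add: inner_add_right)
    ultimately have "x + t *\<^sub>R i \<in> D" using U(3) by blast
    then show "\<exists>t. 0 < \<bar>t\<bar> \<and> \<bar>t\<bar> < e \<and> x + t *\<^sub>R i \<in> D" using t by blast
  qed
qed

text \<open>Reduces a one-sided derivative to the ordinary derivative of an extension
  \<open>F\<close>, which has to agree with \<open>f\<close> only on \<open>D\<close> near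
  \<open>x\<close>. Boundary points thus need no separate calculation.\<close>

lemma dder_eqI:
  fixes D :: "'a::euclidean_space set"
  assumes "half_space_like D" "x \<in> D" "(F has_derivative F') (at x)"
    and "open U" "x \<in> U" "\<And>y. y \<in> D \<inter> U \<Longrightarrow> f y = F y"
  shows "dder D f x v = F' v"
proof -
  have "(f has_derivative F') (at x within D)"
  proof (rule has_derivative_transform_eventually)
    show "(F has_derivative F') (at x within D)" using assms(3) has_derivative_at_withinI by blast
    show "\<forall>\<^sub>F x' in at x within D. F x' = f x'"
      using assms by (auto simp: eventually_at_topological)
  qed (use assms in auto)
  then show ?thesis
    by (simp add: dder_def frechet_derivative_within_half_space_like[OF assms(1,2)])
qed

section \<open>Stereographic coordinates\<close>

definition tproj :: "'a::euclidean_space \<Rightarrow> 'a \<Rightarrow> 'a" where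
  "tproj u x = x - (x \<bullet> u) *\<^sub>R u"

text \<open>The conformal factor of inverse stereographic projection: the round metric pulls back to
  \<open>(cfac u x)\<^sup>2\<close> times the Euclidean metric of the hyperplane orthogonal to
  \<open>u\<close>.\<close>

definition cfac :: "'a::euclidean_space \<Rightarrow> 'a \<Rightarrow> real" where
  "cfac u x = 2 / (1 + (norm (tproj u x))\<^sup>2)"

lemma tproj_simps [simp]:
  "tproj u 0 = 0"
  "tproj u (x + y) = tproj u x + tproj u y"
  "tproj u (x - y) = tproj u x - tproj u y"
  "tproj u (- x) = - tproj u x"
  "tproj u (c *\<^sub>R x) = c *\<^sub>R tproj u x"
  by (simp_all add: tproj_def algebra_simps)

lemma bounded_linear_tproj: "bounded_linear (tproj u)"
  by (simp add: linear_conv_bounded_linear[symmetric] linear_iff)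

lemma has_derivative_tproj [derivative_intros]:
  "(f has_derivative f') F \<Longrightarrow> ((\<lambda>x. tproj u (f x)) has_derivative (\<lambda>v. tproj u (f' v))) F"
  by (rule bounded_linear.has_derivative[OF bounded_linear_tproj])

lemma tproj_unit_simps [simp]:
  assumes "norm u = 1"
  shows "tproj u u = 0" "tproj u x \<bullet> u = 0" "u \<bullet> tproj u x = 0" "tproj u (tproj u x) = tproj u x"
proof -
  have "u \<bullet> u = 1" using assms by (simp add: norm_eq_1)
  then show "tproj u u = 0" "tproj u x \<bullet> u = 0" "u \<bullet> tproj u x = 0" "tproj u (tproj u x) = tproj u x"
    by (simp_all add: tproj_def algebra_simps inner_commute)
qed

lemma tproj_decomp: "x = (x \<bullet> u) *\<^sub>R u + tproj u x"
  by (simp add: tproj_def)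

lemma cfac_pos: "cfac u x > 0"
  by (simp add: cfac_def add_pos_nonneg)

lemma cfac_norm: "cfac u x * (tproj u x \<bullet> tproj u x) = 2 - cfac u x"
proof -
  have "1 + tproj u x \<bullet> tproj u x > 0" by (simp add: add_pos_nonneg)
  then show ?thesis by (simp add: cfac_def power2_norm_eq_inner field_simps)
qed

lemma has_derivative_cfac:
  "(cfac u has_derivative (\<lambda>v. - (cfac u x)\<^sup>2 * (tproj u x \<bullet> tproj u v))) (at x)"
proof -
  have pos: "1 + tproj u x \<bullet> tproj u x > 0" for x by (simp add: add_pos_nonneg)
  have "((\<lambda>x. 2 / (1 + tproj u x \<bullet> tproj u x)) has_derivative
      (\<lambda>v. - (2 / (1 + tproj u x \<bullet> tproj u x))\<^sup>2 * (tproj u x \<bullet> tproj u v))) (at x)"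
    using pos[of x]
    by (auto intro!: derivative_eq_intros simp: fun_eq_iff field_simps power2_eq_square inner_commute)
  then show ?thesis by (simp add: cfac_def[abs_def] power2_norm_eq_inner)
qed

lemma stereo_par_eq: "stereo_par u x = (x \<bullet> u, cfac u x *\<^sub>R tproj u x + (1 - cfac u x) *\<^sub>R u)"
proof -
  have pos: "1 + (norm (tproj u x))\<^sup>2 > 0" by (simp add: add_pos_nonneg)
  have "((norm (tproj u x))\<^sup>2 - 1) / (1 + (norm (tproj u x))\<^sup>2) = 1 - cfac u x"
    using pos by (simp add: cfac_def field_simps)
  then show ?thesis
    by (simp add: stereo_par_def Let_def tproj_def[symmetric] scaleR_right_distrib cfac_def)
qed

lemma has_derivative_stereo_par:
  "(stereo_par u has_derivative (\<lambda>v. (v \<bullet> u,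
     cfac u x *\<^sub>R tproj u v - ((cfac u x)\<^sup>2 * (tproj u x \<bullet> tproj u v)) *\<^sub>R (tproj u x - u)))) (at x)"
proof -
  have "((\<lambda>x. (x \<bullet> u, cfac u x *\<^sub>R tproj u x + (1 - cfac u x) *\<^sub>R u)) has_derivative (\<lambda>v. (v \<bullet> u,
     cfac u x *\<^sub>R tproj u v - ((cfac u x)\<^sup>2 * (tproj u x \<bullet> tproj u v)) *\<^sub>R (tproj u x - u)))) (at x)"
    by (auto intro!: derivative_eq_intros has_derivative_cfac simp: fun_eq_iff algebra_simps)
  then show ?thesis by (simp add: stereo_par_eq[abs_def])
qed

lemma cmet_stereo_chart:
  assumes "norm u = 1"
  shows "cmet (stereo_chart r u) x v w =
    (v \<bullet> u) * (w \<bullet> u) + (r (x \<bullet> u) * cfac u x)\<^sup>2 * (tproj u v \<bullet> tproj u w)"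
proof -
  define \<rho> where "\<rho> = cfac u x"
  define y where "y = tproj u x"
  define v' where "v' = tproj u v"
  define w' where "w' = tproj u w"
  have uu: "u \<bullet> u = 1" using assms by (simp add: norm_eq_1)
  have o: "y \<bullet> u = 0" "v' \<bullet> u = 0" "w' \<bullet> u = 0" "u \<bullet> y = 0" "u \<bullet> v' = 0" "u \<bullet> w' = 0"
    using assms by (simp_all add: y_def v'_def w'_def)
  have yy: "\<rho> * (y \<bullet> y) = 2 - \<rho>"
    unfolding \<rho>_def y_def by (rule cfac_norm)
  \<comment> \<open>The mixed products collect in one summand with the factor
    \<open>\<rho> * (y \<bullet> y) + \<rho> - 2\<close>, which \<open>yy\<close> makes zero:
    stereographic projection is conformal.\<close>
  have "(\<rho> *\<^sub>R v' - (\<rho>\<^sup>2 * (y \<bullet> v')) *\<^sub>R (y - u)) \<bullet> (\<rho> *\<^sub>R w' - (\<rho>\<^sup>2 * (y \<bullet> w')) *\<^sub>R (y - u))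
    = \<rho>\<^sup>2 * (v' \<bullet> w') + \<rho>^3 * (y \<bullet> v') * (y \<bullet> w') * (\<rho> * (y \<bullet> y) + \<rho> - 2)"
    by (simp add: inner_diff_left inner_diff_right o uu inner_commute[of v' y] power2_eq_square power3_eq_cube algebra_simps)
  then have "(\<rho> *\<^sub>R v' - (\<rho>\<^sup>2 * (y \<bullet> v')) *\<^sub>R (y - u)) \<bullet> (\<rho> *\<^sub>R w' - (\<rho>\<^sup>2 * (y \<bullet> w')) *\<^sub>R (y - u))
    = \<rho>\<^sup>2 * (v' \<bullet> w')"
    by (simp add: yy)
  then show ?thesis
    by (simp add: stereo_chart_def warped_metric_def frechet_derivative_at[symmetric, OF has_derivative_stereo_par]
        stereo_par_eq \<rho>_def y_def v'_def w'_def power_mult_distrib)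
qed

section \<open>Curvature of a warped product in stereographic coordinates\<close>

text \<open>The trace of the rank-one map taking z to \<open>l z\<close> times \<open>q\<close>. The
  Ricci and Laplacian traces are split into such maps and multiples of
  \<open>tproj u\<close>.\<close>

lemma trace_linear:
  fixes l :: "'a::euclidean_space \<Rightarrow> real"
  assumes "linear l"
  shows "(\<Sum>b\<in>Basis. l b * (q \<bullet> b)) = l q"
proof -
  have "l q = l (\<Sum>b\<in>Basis. (q \<bullet> b) *\<^sub>R b)" by (simp add: euclidean_representation)
  also have "\<dots> = (\<Sum>b\<in>Basis. l b * (q \<bullet> b))"
    using assms by (simp add: linear_sum linear_scale mult.commute)
  finally show ?thesis by simp
qed

lemma trace_tproj:
  fixes u :: "'a::euclidean_space"
  assumes "norm u = 1"
  shows "(\<Sum>b\<in>Basis. tproj u b \<bullet> b) = real DIM('a) - 1"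
proof -
  have "(\<Sum>b\<in>Basis. tproj u b \<bullet> b) = (\<Sum>b\<in>(Basis::'a set). 1) - (\<Sum>b\<in>Basis. (b \<bullet> u) * (u \<bullet> b))"
    unfolding sum_subtractf[symmetric]
    by (rule sum.cong) (simp_all add: tproj_def inner_diff_left)
  also have "(\<Sum>b\<in>Basis. (b \<bullet> u) * (u \<bullet> b)) = u \<bullet> u"
    by (rule trace_linear) (simp add: linear_iff inner_add_left)
  finally show ?thesis using assms by (simp add: norm_eq_1)
qed

lemma sharp_eqI:
  assumes "bilinear (G x)" "\<And>v. v \<noteq> 0 \<Longrightarrow> G x v v > 0" "\<And>e. G x z e = l e"
  shows "sharp G x l = z"
  unfolding sharp_def
proof (rule the_equality)
  fix z' assume "\<forall>e. G x z' e = l e"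
  then have "G x (z' - z) (z' - z) = 0"
    using assms(3) bilinear_lsub[OF assms(1)] by simp
  then show "z' = z" using assms(2)[of "z' - z"] by force
qed (use assms(3) in blast)

locale warped_stereo =
  fixes r r1 r2 :: "real \<Rightarrow> real" and u :: "'a::euclidean_space"
  assumes u: "norm u = 1"
    and r_pos: "r s > 0"
    and r_deriv: "(r has_real_derivative r1 s) (at s)"
    and r1_deriv: "(r1 has_real_derivative r2 s) (at s)"
begin

abbreviation G where "G \<equiv> cmet (stereo_chart r u)"
abbreviation P where "P \<equiv> tproj u"
abbreviation \<rho> where "\<rho> \<equiv> cfac u"

definition \<phi> where "\<phi> x = (r (x \<bullet> u) * \<rho> x)\<^sup>2"
definition p where "p x = r1 (x \<bullet> u) / r (x \<bullet> u)"
definition p1 where "p1 x = r2 (x \<bullet> u) / r (x \<bullet> u) - (p x)\<^sup>2"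

text \<open>\<open>b x\<close> is half the differential of \<open>ln \<phi>\<close>.\<close>

definition b where "b x v = p x * (v \<bullet> u) - \<rho> x * (P x \<bullet> P v)"
text \<open>The vector dual under \<open>G x\<close> to the form - \<phi> b, that is, - \<phi> times
  the gradient of half of ln \<phi>.\<close>

definition N where "N x = \<rho> x *\<^sub>R P x - (\<phi> x * p x) *\<^sub>R u"
definition Gam where "Gam x v w = b x v *\<^sub>R P w + b x w *\<^sub>R P v + (P v \<bullet> P w) *\<^sub>R N x"

lemma uu [simp]: "u \<bullet> u = 1" using u by (simp add: norm_eq_1)

lemmas P_simps [simp] = tproj_unit_simps[OF u]

lemma G_eq: "G x v w = (v \<bullet> u) * (w \<bullet> u) + \<phi> x * (P v \<bullet> P w)"
  by (simp add: cmet_stereo_chart[OF u] \<phi>_def)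

lemma \<phi>_pos: "\<phi> x > 0"
  using r_pos[of "x \<bullet> u"] cfac_pos[of u x] by (simp add: \<phi>_def)

lemma G_bilinear: "bilinear (G x)"
  by (simp add: bilinear_def linear_iff G_eq inner_add_left inner_add_right algebra_simps)

lemma G_pos: "v \<noteq> 0 \<Longrightarrow> G x v v > 0"
proof -
  assume "v \<noteq> 0"
  show ?thesis
  proof (cases "P v = 0")
    case True
    then have "v \<bullet> u \<noteq> 0" using \<open>v \<noteq> 0\<close> tproj_decomp[of v u] by auto
    then show ?thesis by (simp add: G_eq True) (metis not_real_square_gt_zero)
  next
    case False
    then show ?thesis using \<phi>_pos[of x] by (simp add: G_eq add_nonneg_pos)
  qed
qed

lemma sharp_G_eqI: "(\<And>e. G x z e = l e) \<Longrightarrow> sharp G x l = z"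
  by (rule sharp_eqI[where G=G]) (use G_bilinear G_pos in auto)

lemma p_has_derivative: "(p has_derivative (\<lambda>z. p1 x * (z \<bullet> u))) (at x)"
proof -
  have d: "((\<lambda>s. r1 s / r s) has_real_derivative (p1 x)) (at (x \<bullet> u))"
    using r_pos[of "x \<bullet> u"]
    by (auto intro!: derivative_eq_intros r_deriv r1_deriv simp: p1_def p_def field_simps power2_eq_square)
  have "((\<lambda>x. x \<bullet> u) has_derivative (\<lambda>z. z \<bullet> u)) (at x)"
    by (auto intro!: derivative_eq_intros)
  from has_derivative_compose[OF this d[unfolded has_field_derivative_def]]
  show ?thesis unfolding p_def[abs_def] .
qed

lemma \<phi>_has_derivative: "(\<phi> has_derivative (\<lambda>z. 2 * \<phi> x * b x z)) (at x)"
proof -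
  have "((\<lambda>x. x \<bullet> u) has_derivative (\<lambda>z. z \<bullet> u)) (at x)"
    by (auto intro!: derivative_eq_intros)
  note d = has_derivative_compose[OF this r_deriv[unfolded has_field_derivative_def]]
  have "((\<lambda>x. (r (x \<bullet> u) * \<rho> x)\<^sup>2) has_derivative (\<lambda>z. 2 * \<phi> x * b x z)) (at x)"
    using r_pos[of "x \<bullet> u"]
    by (auto intro!: derivative_eq_intros d has_derivative_cfac
        simp: fun_eq_iff \<phi>_def b_def p_def field_simps power2_eq_square)
  then show ?thesis unfolding \<phi>_def[abs_def] .
qed

definition B where
  "B x z v = p1 x * (z \<bullet> u) * (v \<bullet> u) - \<rho> x * (P z \<bullet> P v) + (\<rho> x)\<^sup>2 * (P x \<bullet> P z) * (P x \<bullet> P v)"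

lemma b_has_derivative: "((\<lambda>x. b x v) has_derivative (\<lambda>z. B x z v)) (at x)"
  unfolding b_def B_def
  by (auto intro!: derivative_eq_intros p_has_derivative has_derivative_cfac
        simp: fun_eq_iff algebra_simps power2_eq_square)

definition DN where
  "DN x z = \<rho> x *\<^sub>R P z - ((\<rho> x)\<^sup>2 * (P x \<bullet> P z)) *\<^sub>R P x - (\<phi> x * (2 * b x z * p x + p1 x * (z \<bullet> u))) *\<^sub>R u"

lemma N_has_derivative: "(N has_derivative DN x) (at x)"
proof -
  have "((\<lambda>x. \<rho> x *\<^sub>R P x - (\<phi> x * p x) *\<^sub>R u) has_derivative DN x) (at x)"
    by (auto intro!: derivative_eq_intros p_has_derivative has_derivative_cfac \<phi>_has_derivative
        simp: fun_eq_iff algebra_simps DN_def)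
  then show ?thesis by (simp add: N_def[abs_def])
qed

definition DGam where "DGam x z v w = B x z v *\<^sub>R P w + B x z w *\<^sub>R P v + (P v \<bullet> P w) *\<^sub>R DN x z"

lemma Gam_has_derivative: "((\<lambda>x. Gam x v w) has_derivative (\<lambda>z. DGam x z v w)) (at x)"
  unfolding Gam_def DGam_def
  by (auto intro!: derivative_eq_intros b_has_derivative N_has_derivative)

lemma Gam_u: "Gam x v w \<bullet> u = - (P v \<bullet> P w) * \<phi> x * p x"
  by (simp add: Gam_def N_def inner_add_left inner_diff_left)

lemma P_Gam: "P (Gam x v w) = b x v *\<^sub>R P w + b x w *\<^sub>R P v + (P v \<bullet> P w) *\<^sub>R (\<rho> x *\<^sub>R P x)"
  by (simp add: Gam_def N_def)

context
  fixes D :: "'a set" and x :: 'a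
  assumes D: "half_space_like D"
begin

lemma dder_G: "x \<in> D \<Longrightarrow> dder D (\<lambda>y. G y v w) x z = 2 * \<phi> x * b x z * (P v \<bullet> P w)"
  by (rule dder_eqI[OF D _ _ open_UNIV UNIV_I refl])
     (auto simp: G_eq intro!: derivative_eq_intros \<phi>_has_derivative)

text \<open>Only the spherical part of the metric varies, with logarithmic derivative 2 b. In the
  Koszul formula the first two derivatives are dual to the terms along \<open>P w\<close> and
  \<open>P v\<close>; the third one yields \<open>N x\<close>.\<close>

lemma christoffel_eq: "x \<in> D \<Longrightarrow> christoffel D G x v w = Gam x v w"
  unfolding christoffel_def
proof (rule sharp_G_eqI)
  fix e
  assume "x \<in> D"
  then have "(dder D (\<lambda>y. G y w e) x v + dder D (\<lambda>y. G y v e) x w - dder D (\<lambda>y. G y v w) x e) / 2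
      = \<phi> x * (b x v * (P w \<bullet> P e) + b x w * (P v \<bullet> P e) - b x e * (P v \<bullet> P w))"
    by (simp add: dder_G field_simps)
  also have "\<dots> = G x (Gam x v w) e"
    unfolding G_eq Gam_u P_Gam by (simp add: inner_add_left b_def[of x e] algebra_simps)
  finally show "G x (Gam x v w) e =
    (dder D (\<lambda>y. G y w e) x v + dder D (\<lambda>y. G y v e) x w - dder D (\<lambda>y. G y v w) x e) / 2" ..
qed

end

lemma dder_christoffel:
  assumes "half_space_like D" "x \<in> D"
  shows "dder D (\<lambda>y. christoffel D G y v w) x z = DGam x z v w"
  by (rule dder_eqI[OF assms Gam_has_derivative open_UNIV UNIV_I])
     (use assms in \<open>auto simp: christoffel_eq\<close>)

lemma riemann_eq:
  assumes "half_space_like D" "x \<in> D"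
  shows "riemann D G x z v w =
    DGam x z v w - DGam x v z w + Gam x z (Gam x v w) - Gam x v (Gam x z w)"
  using assms by (simp add: riemann_def dder_christoffel christoffel_eq)

lemma b_linear: "b x (v + w) = b x v + b x w" "b x (c *\<^sub>R v) = c * b x v"
  by (simp_all add: b_def inner_add_left inner_add_right algebra_simps)

lemma b_Gam: "b x (Gam x v w) = b x v * b x (P w) + b x w * b x (P v) + (P v \<bullet> P w) * b x (N x)"
  by (simp add: Gam_def b_linear)

text \<open>Sorted by the way \<open>z\<close> enters, so that the trace over \<open>z\<close> can be read off.\<close>

lemma riemann_expand:
  "DGam x z v w - DGam x v z w + Gam x z (Gam x v w) - Gam x v (Gam x z w) =
     (B x z w) *\<^sub>R P v + (P v \<bullet> P w) *\<^sub>R DN x z - (P z \<bullet> P w) *\<^sub>R DN x v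
     + (b x (Gam x v w) - B x v w - b x v * b x w) *\<^sub>R P z
     + (b x z) *\<^sub>R (P (Gam x v w) - b x v *\<^sub>R P w)
     + (P (Gam x v w) \<bullet> P z) *\<^sub>R N x
     - (P z \<bullet> P w) *\<^sub>R (b x v *\<^sub>R \<rho> x *\<^sub>R P x)
     - (b x (Gam x z w)) *\<^sub>R P v
     - (P v \<bullet> P (Gam x z w)) *\<^sub>R N x"
  unfolding DGam_def Gam_def[of x z "Gam x v w"] Gam_def[of x v "Gam x z w"] P_Gam[of x z w]
  by (simp add: B_def inner_commute algebra_simps)


lemma b_N: "b x (N x) = - \<phi> x * (p x)\<^sup>2 - (\<rho> x)\<^sup>2 * (P x \<bullet> P x)"
  by (simp add: b_def N_def inner_diff_left inner_diff_right power2_eq_square algebra_simps)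

text \<open>The warped product formula Ric = - (n - 1) (r'' / r) ds^2 + ((n - 2) (1 - r'^2) - r r'')
  h, with h = \<rho>^2 |dy|^2. The summands of \<open>riemann_expand\<close> have rank one in
  \<open>z\<close>, apart from the multiples of \<open>P z\<close> and \<open>DN x z\<close>, whose
  traces are \<open>tP\<close> and \<open>tDN\<close>.\<close>

lemma ricci_eq:
  assumes "half_space_like D" "x \<in> D"
  shows "ricci D G x v w = - (real DIM('a) - 1) * (r2 (x \<bullet> u) / r (x \<bullet> u)) * (v \<bullet> u) * (w \<bullet> u)
    + (\<rho> x)\<^sup>2 * (P v \<bullet> P w) * ((real DIM('a) - 2) * (1 - (r1 (x \<bullet> u))\<^sup>2) - r (x \<bullet> u) * r2 (x \<bullet> u))"
proof -
  let ?n = "real DIM('a) - 1"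
  note lin = linear_iff inner_add_left inner_add_right b_linear algebra_simps
  have tP: "(\<Sum>z\<in>Basis. c * (P z \<bullet> z)) = c * ?n" for c
    by (simp add: sum_distrib_left[symmetric] trace_tproj[OF u])
  have tDN: "(\<Sum>z\<in>Basis. c * (DN x z \<bullet> z)) = c * (\<rho> x * ?n - (\<rho> x)\<^sup>2 * (P x \<bullet> P x)
      - \<phi> x * (2 * (p x)\<^sup>2 + p1 x))" for c
  proof -
    have "(\<Sum>z\<in>Basis. DN x z \<bullet> z) = (\<Sum>z\<in>Basis. \<rho> x * (P z \<bullet> z))
      - (\<Sum>z\<in>Basis. ((\<rho> x)\<^sup>2 * (P x \<bullet> P z)) * (P x \<bullet> z))
      - (\<Sum>z\<in>Basis. (\<phi> x * (2 * b x z * p x + p1 x * (z \<bullet> u))) * (u \<bullet> z))"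
      by (simp add: DN_def inner_diff_left sum_subtractf)
    also have "\<dots> = \<rho> x * ?n - (\<rho> x)\<^sup>2 * (P x \<bullet> P x) - \<phi> x * (2 * (p x)\<^sup>2 + p1 x)"
      by (subst tP, subst trace_linear, simp add: lin, subst trace_linear, simp add: lin)
         (simp add: b_def power2_eq_square)
    finally show ?thesis by (simp add: sum_distrib_left[symmetric])
  qed
  have "ricci D G x v w = (\<Sum>z\<in>Basis. B x z w * (P v \<bullet> z)) + (\<Sum>z\<in>Basis. (P v \<bullet> P w) * (DN x z \<bullet> z))
     - (\<Sum>z\<in>Basis. (P z \<bullet> P w) * (DN x v \<bullet> z))
     + (\<Sum>z\<in>Basis. (b x (Gam x v w) - B x v w - b x v * b x w) * (P z \<bullet> z))
     + (\<Sum>z\<in>Basis. b x z * ((P (Gam x v w) - b x v *\<^sub>R P w) \<bullet> z))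
     + (\<Sum>z\<in>Basis. (P (Gam x v w) \<bullet> P z) * (N x \<bullet> z))
     - (\<Sum>z\<in>Basis. (P z \<bullet> P w) * ((b x v *\<^sub>R \<rho> x *\<^sub>R P x) \<bullet> z))
     - (\<Sum>z\<in>Basis. b x (Gam x z w) * (P v \<bullet> z))
     - (\<Sum>z\<in>Basis. (P v \<bullet> P (Gam x z w)) * (N x \<bullet> z))"
    unfolding ricci_def riemann_eq[OF assms] riemann_expand
    by (simp only: inner_add_left inner_diff_left inner_scaleR_left sum.distrib sum_subtractf)
  also have "\<dots> = B x (P v) w + (P v \<bullet> P w) * (\<rho> x * ?n - (\<rho> x)\<^sup>2 * (P x \<bullet> P x) - \<phi> x * (2 * (p x)\<^sup>2 + p1 x))
     - (P (DN x v) \<bullet> P w)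
     + (b x (Gam x v w) - B x v w - b x v * b x w) * ?n
     + b x (P (Gam x v w) - b x v *\<^sub>R P w)
     + (P (Gam x v w) \<bullet> P (N x))
     - (P (b x v *\<^sub>R \<rho> x *\<^sub>R P x) \<bullet> P w)
     - b x (Gam x (P v) w)
     - (P v \<bullet> P (Gam x (N x) w))"
  proof -
    have l: "linear (\<lambda>z. B x z w)" "linear (\<lambda>z. P z \<bullet> P w)" "linear (b x)"
      "linear (\<lambda>z. P (Gam x v w) \<bullet> P z)" "linear (\<lambda>z. b x (Gam x z w))" "linear (\<lambda>z. P v \<bullet> P (Gam x z w))"
      by (simp_all add: B_def Gam_def lin)
    show ?thesis
      unfolding tP tDN l[THEN trace_linear] ..
  qed
  finally have *: "ricci D G x v w = \<dots>" .
  \<comment> \<open>What remains is an identity between scalars. The names turn the inner products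
    into atoms for the algebra, linked by the relation \<open>Y\<close>.\<close>
  define \<rho>' \<phi>' n V vu wu yv yw Y p' p1' where defs: "\<rho>' = \<rho> x" "\<phi>' = \<phi> x" "n = real DIM('a)" "V = P v \<bullet> P w"
    "vu = v \<bullet> u" "wu = w \<bullet> u" "yv = P x \<bullet> P v" "yw = P x \<bullet> P w" "Y = P x \<bullet> P x" "p' = p x" "p1' = p1 x"
  have Y: "\<rho>' * Y = 2 - \<rho>'" unfolding defs by (rule cfac_norm)
  have e1: "b x v = p' * vu - \<rho>' * yv" "b x w = p' * wu - \<rho>' * yw" "b x (P v) = - \<rho>' * yv" "b x (P w) = - \<rho>' * yw"
    "b x (N x) = - \<phi>' * p'\<^sup>2 - \<rho>' * (2 - \<rho>')"
    unfolding Y[symmetric] b_N by (simp_all add: b_def defs power2_eq_square)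
  have e2: "B x v w = p1' * vu * wu - \<rho>' * V + \<rho>'\<^sup>2 * yv * yw" "B x (P v) w = - \<rho>' * V + \<rho>'\<^sup>2 * yv * yw"
    by (simp_all add: B_def defs)
  have e3: "P (DN x v) \<bullet> P w = \<rho>' * V - \<rho>'\<^sup>2 * yv * yw"
    by (simp add: DN_def defs inner_diff_left)
  have e4: "b x (Gam x v w) = b x v * (- \<rho>' * yw) + b x w * (- \<rho>' * yv) + V * b x (N x)"
    unfolding b_Gam e1 by (simp add: defs)
  have e5: "b x (Gam x (P v) w) = b x (P v) * (- \<rho>' * yw) + b x w * (- \<rho>' * yv) + V * b x (N x)"
    unfolding b_Gam e1 by (simp add: defs e1)
  \<comment> \<open>On vectors orthogonal to \<open>u\<close> the form \<open>b x\<close> is minus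
    the inner product with \<open>P (N x)\<close>, so the two traces cancel up to the contribution
    of \<open>b x v *\<^sub>R P w\<close>.\<close>
  have e6: "b x (P (Gam x v w) - b x v *\<^sub>R P w) + (P (Gam x v w) \<bullet> P (N x)) = b x v * \<rho>' * yw"
  proof -
    have "b x (P z) = - (P z \<bullet> P (N x))" for z
      by (simp add: b_def N_def inner_commute)
    moreover have "P (N x) = \<rho>' *\<^sub>R P x" by (simp add: N_def defs)
    moreover have "P (Gam x v w) - b x v *\<^sub>R P w = P (Gam x v w - b x v *\<^sub>R P w)" by simp
    ultimately show ?thesis
      by (simp only:) (simp add: inner_diff_left inner_diff_right defs inner_commute algebra_simps)
  qed
  have e7: "P (b x v *\<^sub>R \<rho> x *\<^sub>R P x) \<bullet> P w = b x v * \<rho>' * yw"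
    by (simp add: defs)
  have e8: "P v \<bullet> P (Gam x (N x) w) = b x (N x) * V + b x w * \<rho>' * yv + \<rho>'\<^sup>2 * yv * yw"
    unfolding P_Gam by (simp add: N_def defs inner_add_right inner_commute power2_eq_square)
  have "ricci D G x v w = - (n - 1) * (p1' + p'\<^sup>2) * vu * wu
      + V * ((n - 2) * \<rho>'\<^sup>2 - \<phi>' * (p1' + (n - 1) * p'\<^sup>2))"
  proof -
    have Y2: "V * (\<rho>'\<^sup>2 * Y) = V * (\<rho>' * (2 - \<rho>'))" by (simp add: Y[symmetric] power2_eq_square)
    show ?thesis
      unfolding * e2 e3 e4 e5 e7 e8
      using e6 Y2 unfolding e1 defs(1-4)[symmetric] defs(9-11)[symmetric]
      by (simp add: e1 algebra_simps power2_eq_square)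
  qed
  also have "p1' + p'\<^sup>2 = r2 (x \<bullet> u) / r (x \<bullet> u)"
    by (simp add: defs p1_def)
  also have "\<phi>' * (p1' + (n - 1) * p'\<^sup>2) = \<rho>'\<^sup>2 * (r (x \<bullet> u) * r2 (x \<bullet> u) + (n - 2) * (r1 (x \<bullet> u))\<^sup>2)"
    using r_pos[of "x \<bullet> u"] by (simp add: defs p1_def p_def \<phi>_def field_simps power2_eq_square)
  finally show ?thesis
    by (simp add: defs algebra_simps)
qed


section \<open>Hessian, Laplacian and critical equation of radial functions\<close>

context
  fixes D :: "'a set" and l l1 l2 :: "real \<Rightarrow> real" and f :: "'a \<Rightarrow> real"
  assumes D: "half_space_like D"
    and l: "\<And>s. (l has_real_derivative l1 s) (at s)"
    and l1: "\<And>s. (l1 has_real_derivative l2 s) (at s)"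
    and f: "\<And>x. x \<in> D \<Longrightarrow> f x = l (x \<bullet> u)"
begin

lemma hessian_eq:
  assumes "x \<in> D"
  shows "hessian D G f x v w = l2 (x \<bullet> u) * (v \<bullet> u) * (w \<bullet> u) + l1 (x \<bullet> u) * p x * \<phi> x * (P v \<bullet> P w)"
proof -
  have h: "((\<lambda>x. x \<bullet> u) has_derivative (\<lambda>z. z \<bullet> u)) (at x)" for x
    by (auto intro!: derivative_eq_intros)
  have d1: "dder D f y w = l1 (y \<bullet> u) * (w \<bullet> u)" if "y \<in> D" for y w
    by (rule dder_eqI[OF D that has_derivative_compose[OF h l[unfolded has_field_derivative_def]] open_UNIV UNIV_I])
       (simp add: f)
  have "((\<lambda>y. l1 (y \<bullet> u) * (w \<bullet> u)) has_derivative (\<lambda>z. l2 (x \<bullet> u) * (z \<bullet> u) * (w \<bullet> u))) (at x)"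
    by (rule has_derivative_mult_left[OF has_derivative_compose[OF h l1[unfolded has_field_derivative_def]]])
  then have "dder D (\<lambda>y. dder D f y w) x v = l2 (x \<bullet> u) * (v \<bullet> u) * (w \<bullet> u)"
    by (rule dder_eqI[OF D assms _ open_UNIV UNIV_I]) (simp add: d1)
  then show ?thesis
    by (simp add: hessian_def d1[OF assms] christoffel_eq[OF D assms] Gam_u algebra_simps)
qed

lemma laplacian_eq:
  assumes "x \<in> D"
  shows "laplacian D G f x = l2 (x \<bullet> u) + (real DIM('a) - 1) * (l1 (x \<bullet> u) * p x)"
proof -
  have "sharp G x (hessian D G f x z) = (l2 (x \<bullet> u) * (z \<bullet> u)) *\<^sub>R u + (l1 (x \<bullet> u) * p x) *\<^sub>R P z" for z
    by (rule sharp_G_eqI)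
       (simp add: G_eq hessian_eq[OF assms] inner_add_left algebra_simps)
  then have "laplacian D G f x = (\<Sum>z\<in>Basis. l2 (x \<bullet> u) * (z \<bullet> u) * (u \<bullet> z)) + (\<Sum>z\<in>Basis. l1 (x \<bullet> u) * p x * (P z \<bullet> z))"
    by (simp add: laplacian_def inner_add_left sum.distrib)
  also have "\<dots> = l2 (x \<bullet> u) * (u \<bullet> u) + l1 (x \<bullet> u) * p x * (real DIM('a) - 1)"
    unfolding sum_distrib_left[symmetric] trace_tproj[OF u]
    by (subst trace_linear) (simp_all add: linear_iff inner_add_left algebra_simps)
  finally show ?thesis by simp
qed

text \<open>The tensor equation has two components. Along ds^2 the \<open>l2\<close> of the
  Laplacian cancels that of the Hessian, which leaves an equation of first order. Along the slices
  the Hessian cancels one of the n - 1 terms with \<open>l1\<close>, hence the factor n - 2.\<close>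

lemma critical_equation_radial:
  assumes "x \<in> D" "s = x \<bullet> u"
    and "r1 s * l1 s - r2 s * l s = - r s / (real DIM('a) - 1)" "real DIM('a) > 1"
    and "l2 s + (real DIM('a) - 2) * (r1 s / r s) * l1 s
      + l s * ((real DIM('a) - 2) * (1 - (r1 s)\<^sup>2) / (r s)\<^sup>2 - r2 s / r s) = - 1"
  shows "- laplacian D G f x * G x v w + hessian D G f x v w - f x * ricci D G x v w = G x v w"
proof -
  let ?n = "real DIM('a)"
  have r: "r s > 0" using r_pos .
  have rad: "(?n - 1) * (r1 s * l1 s / r s - l s * r2 s / r s) = - 1"
    using assms(3,4) r by (simp add: field_simps)
  have sph: "l2 s + (?n - 2) * (l1 s * p x) + l s * ((?n - 2) * (1 - (r1 s)\<^sup>2) / (r s)\<^sup>2 - r2 s / r s) = - 1"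
    using assms(5) by (simp add: p_def assms(2) mult.commute mult.left_commute)
  have ric: "ricci D G x v w = - (?n - 1) * (r2 s / r s) * (v \<bullet> u) * (w \<bullet> u)
    + \<phi> x * (P v \<bullet> P w) * ((?n - 2) * (1 - (r1 s)\<^sup>2) / (r s)\<^sup>2 - r2 s / r s)"
    using r unfolding ricci_eq[OF D assms(1)] assms(2)[symmetric]
    by (simp add: \<phi>_def assms(2)[symmetric] field_simps power2_eq_square)
  have "- laplacian D G f x * G x v w + hessian D G f x v w - f x * ricci D G x v w - G x v w
    = - ((?n - 1) * (r1 s * l1 s / r s - l s * r2 s / r s) + 1) * (v \<bullet> u) * (w \<bullet> u)
      - (l2 s + (?n - 2) * (l1 s * p x) + l s * ((?n - 2) * (1 - (r1 s)\<^sup>2) / (r s)\<^sup>2 - r2 s / r s) + 1)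
        * \<phi> x * (P v \<bullet> P w)"
    unfolding ric hessian_eq[OF assms(1)] laplacian_eq[OF assms(1)] G_eq f[OF assms(1)] assms(2)[symmetric]
    by (simp add: p_def assms(2)[symmetric] algebra_simps add_divide_distrib diff_divide_distrib)
  then show ?thesis
    unfolding rad sph by simp
qed

end

end

section \<open>The radial equation\<close>

text \<open>While positive, \<open>g\<close> lies below a parabola with leading coefficient -
  \<kappa> / 2, which eventually becomes negative.\<close>

lemma exists_zero_if_concave_while_pos:
  fixes g g' g'' :: "real \<Rightarrow> real"
  assumes g: "\<And>t. (g has_real_derivative g' t) (at t)"
    and g': "\<And>t. (g' has_real_derivative g'' t) (at t)"
    and g'': "\<And>t. g t > 0 \<Longrightarrow> g'' t \<le> - \<kappa>"
    and "g 0 > 0" "\<kappa> > 0"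
  shows "\<exists>t>0. g t = 0"
proof (rule ccontr)
  assume nz: "\<not> (\<exists>t>0. g t = 0)"
  have pos: "g t > 0" if "t \<ge> 0" for t
  proof (rule ccontr)
    assume "\<not> g t > 0"
    then have "\<exists>x\<ge>0. x \<le> t \<and> g x = 0"
      using \<open>g 0 > 0\<close> that by (intro IVT2) (auto intro: DERIV_isCont[OF g])
    then show False using nz \<open>g 0 > 0\<close> by (metis less_eq_real_def order_less_irrefl)
  qed
  have der: "g' t \<le> g' 0 - \<kappa> * t" if "t \<ge> 0" for t
  proof -
    have "(\<lambda>t. g' t + \<kappa> * t) t \<le> (\<lambda>t. g' t + \<kappa> * t) 0"
    proof (rule DERIV_nonpos_imp_nonincreasing[OF that])
      fix x :: real assume "0 \<le> x" "x \<le> t"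
      then show "\<exists>y. ((\<lambda>t. g' t + \<kappa> * t) has_real_derivative y) (at x) \<and> y \<le> 0"
        using g''[OF pos[of x]] by (intro exI[of _ "g'' x + \<kappa>"]) (auto intro!: derivative_eq_intros g')
    qed
    then show ?thesis by simp
  qed
  have bound: "g t \<le> g 0 + g' 0 * t - \<kappa> * t\<^sup>2 / 2" if "t \<ge> 0" for t
  proof -
    have "(\<lambda>t. g t - g' 0 * t + \<kappa> * t\<^sup>2 / 2) t \<le> (\<lambda>t. g t - g' 0 * t + \<kappa> * t\<^sup>2 / 2) 0"
    proof (rule DERIV_nonpos_imp_nonincreasing[OF that])
      fix x :: real assume "0 \<le> x" "x \<le> t"
      then show "\<exists>y. ((\<lambda>t. g t - g' 0 * t + \<kappa> * t\<^sup>2 / 2) has_real_derivative y) (at x) \<and> y \<le> 0"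
        using der[of x] by (intro exI[of _ "g' x - g' 0 + \<kappa> * x"]) (auto intro!: derivative_eq_intros g)
    qed
    then show ?thesis by simp
  qed
  \<comment> \<open>\<open>T\<close> makes \<kappa> T^2 / 2 equal to m T; the summands of
    \<open>m\<close> ensure that \<open>m - g' 0\<close> exceeds \<open>g 0\<close> and that
    \<open>T\<close> is at least 1.\<close>
  define m where "m = \<bar>g' 0\<bar> + g 0 + \<kappa>"
  define T where "T = 2 * m / \<kappa>"
  have m: "m \<ge> \<kappa>" "m \<ge> g' 0" and T: "T \<ge> 1"
    using assms(4,5) by (auto simp: m_def T_def field_simps)
  have "\<kappa> * T\<^sup>2 / 2 = m * T" using assms(5) by (simp add: T_def power2_eq_square)
  then have "g T \<le> g 0 + g' 0 * T - m * T" using bound[of T] T by simp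
  also have "\<dots> = g 0 - (m - g' 0) * T" by (simp add: algebra_simps)
  also have "\<dots> \<le> g 0 - (m - g' 0) * 1"
    using m T by (intro diff_left_mono mult_left_mono) auto
  also have "\<dots> < 0" using assms(5) by (simp add: m_def)
  finally show False using pos[of T] T by simp
qed

lemma exists_antiderivative_real:
  fixes f :: "real \<Rightarrow> real"
  assumes "continuous_on UNIV f"
  obtains F where "F 0 = 0" "\<And>t. (F has_real_derivative f t) (at t)"
proof -
  have "\<exists>F. \<forall>x::real. -\<infinity> < ereal x \<longrightarrow> ereal x < \<infinity> \<longrightarrow> (F has_vector_derivative f x) (at x)"
    using assms by (intro einterval_antiderivative) (auto simp: continuous_on_eq_continuous_at)
  then obtain F where F: "\<And>x. (F has_real_derivative f x) (at x)"
    by (auto simp: has_real_derivative_iff_has_vector_derivative)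
  show thesis
    by (rule that[of "\<lambda>t. F t - F 0"]) (auto intro!: derivative_eq_intros F)
qed

section \<open>The Schwarzschild profile: first integral, evenness, smoothness\<close>

locale schwarzschild_radial =
  fixes n :: nat and a :: real and r :: "real \<Rightarrow> real"
  assumes n: "n \<ge> 3" and profile: "schwarzschild_profile n a r"
begin

definition r1 where "r1 = deriv r"
definition r2 where "r2 s = a / r s ^ (n - 1)"

lemma a_pos: "a > 0" and r_pos: "r s > 0" and r1_0: "r1 0 = 0"
  using profile by (auto simp: schwarzschild_profile_def r1_def)

lemma r_deriv: "(r has_real_derivative r1 s) (at s)"
  using profile unfolding schwarzschild_profile_def r1_def
  by (simp add: DERIV_deriv_iff_real_differentiable)

lemma r1_deriv: "(r1 has_real_derivative r2 s) (at s)"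
proof -
  have "r s powr (1 - real n) = r s powr (- real (n - 1))" using n by (simp add: of_nat_diff)
  also have "\<dots> = 1 / r s ^ (n - 1)"
    using r_pos[of s] by (simp only: powr_minus_divide powr_realpow)
  finally show ?thesis
    using profile unfolding schwarzschild_profile_def r1_def r2_def by (metis mult.right_neutral times_divide_eq_right)
qed

lemma r2_pos: "r2 s > 0"
  using a_pos r_pos[of s] by (simp add: r2_def)

lemma first_integral: "(r1 s)\<^sup>2 = 1 - 2 * a / ((real n - 2) * r s ^ (n - 2))"
proof -
  have "r s powr (2 - real n) = r s powr (- real (n - 2))" using n by (simp add: of_nat_diff)
  also have "\<dots> = 1 / r s ^ (n - 2)"
    using r_pos[of s] by (simp only: powr_minus_divide powr_realpow)
  finally have "r s powr (2 - real n) = 1 / r s ^ (n - 2)" .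
  moreover have "(r1 s)\<^sup>2 + 2 * a / (real n - 2) * r s powr (2 - real n) = 1"
    using profile unfolding schwarzschild_profile_def r1_def by blast
  ultimately show ?thesis by (simp add: eq_diff_eq)
qed

lemma r2_r: "r2 s * r s ^ n = a * r s"
proof -
  have "r s ^ n = r s ^ (n - 1) * r s" using n by (simp add: power_eq_if)
  then show ?thesis using r_pos[of s] by (simp add: r2_def)
qed

text \<open>The form in which the first integral enters the spherical Ricci coefficient, turning it
  into r'' / r. Together with the radial coefficient - (n - 1) r'' / r this is the vanishing of the
  scalar curvature.\<close>

lemma first_integral_r2: "(real n - 2) * (1 - (r1 s)\<^sup>2) / (r s)\<^sup>2 = 2 * r2 s / r s"
proof -
  have "n - 1 = Suc (n - 2)" using n by simp
  then have "r s ^ (n - 1) = r s * r s ^ (n - 2)" by simp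
  moreover have "(real n - 2) * (1 - (r1 s)\<^sup>2) = 2 * a / r s ^ (n - 2)"
    using n by (simp add: first_integral)
  ultimately show ?thesis
    using r_pos[of s] by (simp add: r2_def field_simps power2_eq_square)
qed

lemma r1_strict_mono: "s < t \<Longrightarrow> r1 s < r1 t"
  by (rule DERIV_pos_imp_increasing) (use r1_deriv r2_pos in blast)+

lemma r1_pos: "s > 0 \<Longrightarrow> r1 s > 0" and r1_neg: "s < 0 \<Longrightarrow> r1 s < 0"
  using r1_strict_mono[of 0 s] r1_strict_mono[of s 0] r1_0 by auto

text \<open>Let \<open>d s = r s - r (-s)\<close>.  By the first integral \<open>d'\<close> has the sign of \<open>d\<close> for
  \<open>s > 0\<close>, while \<open>d''\<close> has the opposite sign.  Hence \<open>d'\<^sup>2\<close> is nonincreasing from \<open>0\<close>.\<close>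

lemma r_even: "r (- s) = r s"
proof -
  define d where "d s = r s - r (- s)" for s
  define d1 where "d1 s = r1 s + r1 (- s)" for s
  have d: "(d has_real_derivative d1 s) (at s)" for s
    unfolding d_def[abs_def] d1_def
    by (rule DERIV_cong[OF DERIV_diff[OF r_deriv DERIV_mirror[THEN iffD1, OF r_deriv]]]) simp
  have d1: "(d1 has_real_derivative r2 s - r2 (- s)) (at s)" for s
    unfolding d1_def[abs_def]
    by (rule DERIV_cong[OF DERIV_add[OF r1_deriv DERIV_mirror[THEN iffD1, OF r1_deriv]]]) simp
  have sign: "d1 s * (r2 s - r2 (- s)) \<le> 0" if "s > 0" for s
  proof -
    have sq: "(r1 s)\<^sup>2 \<le> (r1 t)\<^sup>2" "r2 t \<le> r2 s" if "r s \<le> r t" for s t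
    proof -
      have p: "r s ^ m \<le> r t ^ m" "0 < r s ^ m" for m
        using that r_pos[of s] by (simp_all add: power_mono)
      have "2 * a / ((real n - 2) * r t ^ (n - 2)) \<le> 2 * a / ((real n - 2) * r s ^ (n - 2))"
        using n a_pos p[of "n - 2"] r_pos[of t] by (intro divide_left_mono mult_left_mono mult_pos_pos) auto
      then show "(r1 s)\<^sup>2 \<le> (r1 t)\<^sup>2" by (simp add: first_integral)
      show "r2 t \<le> r2 s"
        using a_pos p[of "n - 1"] r_pos[of t] unfolding r2_def by (intro divide_left_mono mult_pos_pos) auto
    qed
    have 1: "r1 s > 0" "- r1 (- s) > 0" using r1_pos r1_neg that by auto
    show ?thesis
    proof (cases "r s \<le> r (- s)")
      case True
      have "r1 s \<le> - r1 (- s)"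
      proof (rule power2_le_imp_le)
        show "(r1 s)\<^sup>2 \<le> (- r1 (- s))\<^sup>2" using sq(1)[OF True] by simp
      qed (use 1 in simp)
      then show ?thesis using sq(2)[OF True] by (auto simp: d1_def mult_le_0_iff)
    next
      case False
      have "- r1 (- s) \<le> r1 s"
      proof (rule power2_le_imp_le)
        show "(- r1 (- s))\<^sup>2 \<le> (r1 s)\<^sup>2" using sq(1)[of "- s" s] False by simp
      qed (use 1 in simp)
      then show ?thesis using sq(2)[of "- s" s] False by (auto simp: d1_def mult_le_0_iff)
    qed
  qed
  have d1_0: "d1 t = 0" if "t \<ge> 0" for t
  proof -
    have "(\<lambda>s. (d1 s)\<^sup>2) t \<le> (\<lambda>s. (d1 s)\<^sup>2) 0"
    proof (rule DERIV_nonpos_imp_nonincreasing[OF that])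
      fix x :: real assume x: "0 \<le> x" "x \<le> t"
      have "d1 x * (r2 x - r2 (- x)) \<le> 0"
        using sign[of x] x by (cases "x = 0") auto
      moreover have "((\<lambda>s. (d1 s)\<^sup>2) has_real_derivative 2 * (d1 x * (r2 x - r2 (- x)))) (at x)"
        by (auto intro!: derivative_eq_intros d1)
      ultimately show "\<exists>y. ((\<lambda>s. (d1 s)\<^sup>2) has_real_derivative y) (at x) \<and> y \<le> 0"
        by (meson mult_nonneg_nonpos zero_le_numeral)
    qed
    then show ?thesis by (simp add: d1_def r1_0)
  qed
  have d0: "d t = 0" if "t \<ge> 0" for t
  proof (cases "t = 0")
    case False
    then have "\<exists>z. 0 < z \<and> z < t \<and> d t - d 0 = (t - 0) * d1 z"
      using d that by (intro MVT2) auto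
    then show ?thesis using d1_0 by (auto simp: d_def)
  qed (simp add: d_def)
  show ?thesis
    using d0[of s] d0[of "- s"] by (cases "s \<ge> 0") (auto simp: d_def)
qed

lemma r1_odd: "r1 (- s) = - r1 s"
proof -
  have "((\<lambda>s. r (- s)) has_real_derivative - r1 (- s)) (at s)"
    by (rule DERIV_mirror[THEN iffD1, OF r_deriv])
  then show ?thesis
    using DERIV_unique[OF _ r_deriv[of s]] by (simp add: r_even)
qed

text \<open>Bootstrapping: \<open>r2\<close> is a rational expression in \<open>r\<close>, so it has
  the order already known for \<open>r\<close>; integrating the system raises the orders of
  \<open>r\<close> and \<open>r1\<close> together.\<close>

lemma Ck_on_r_r1: "Ck_on k UNIV r \<and> Ck_on k UNIV r1"
proof (induction k)
  case 0
  then show ?case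
    using DERIV_continuous_on[OF has_field_derivative_at_within[OF r_deriv]]
      DERIV_continuous_on[OF has_field_derivative_at_within[OF r1_deriv]] by simp
next
  case (Suc k)
  have "r s \<noteq> 0" for s using r_pos[of s] by simp
  then have "Ck_on k UNIV r2"
    unfolding r2_def[abs_def] using Suc by (auto intro!: Ck_on_intros)
  then show ?case
    using Suc by (auto intro!: Ck_on_real_Suc r_deriv r1_deriv simp del: Ck_on.simps)
qed

text \<open>Up to the area of the unit sphere, the signed volume between the horizon and the slice
  at \<open>s\<close>. Normalised at the horizon, it is odd because \<open>r\<close> is
  even.\<close>

definition V where "V = (SOME F. F 0 = 0 \<and> (\<forall>s. (F has_real_derivative r s ^ (n - 1)) (at s)))"

lemma V_0: "V 0 = 0" and V_deriv: "(V has_real_derivative r s ^ (n - 1)) (at s)"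
proof -
  have "continuous_on UNIV (\<lambda>s. r s ^ (n - 1))"
    using Ck_on_r_r1[of 0] by (auto intro: continuous_intros)
  then have "\<exists>F. F 0 = 0 \<and> (\<forall>s. (F has_real_derivative r s ^ (n - 1)) (at s))"
    by (rule exists_antiderivative_real) blast
  from someI_ex[OF this] show "V 0 = 0" "(V has_real_derivative r s ^ (n - 1)) (at s)"
    by (auto simp: V_def)
qed

lemma V_odd: "V (- s) = - V s"
proof -
  have "((\<lambda>s. V (- s) + V s) has_real_derivative 0) (at s)" for s
    by (rule DERIV_cong[OF DERIV_add[OF DERIV_mirror[THEN iffD1, OF V_deriv] V_deriv]]) (simp add: r_even)
  from DERIV_isconst_all[OF allI[OF this], of s 0] show ?thesis by (simp add: V_0)
qed

text \<open>The solutions of \<open>r' \<lambda>' - r'' \<lambda> = - r / (n - 1)\<close>.  They come from the ansatz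
  \<open>\<lambda> = \<alpha> + k r'\<close>: for \<open>\<alpha> = r\<^sup>n / (a (n - 1))\<close> the equation becomes
  \<open>k' = - n r\<^sup>n\<^sup>-\<^sup>1 / (a (n - 1))\<close>, which is regular at the horizon, where \<open>r' = 0\<close>.\<close>

definition k where "k c s = c - real n * V s / (a * (real n - 1))"
definition lam where "lam c s = r s ^ n / (a * (real n - 1)) + r1 s * k c s"
definition lam1 where "lam1 c s = r2 s * k c s"
definition lam2 where "lam2 c s = - 1 / (real n - 1) - (real n - 1) * (r2 s / r s) * lam c s"

lemma n1: "real n - 1 > 0" "real n > 1" using n by auto

lemma k_deriv: "(k c has_real_derivative - real n * r s ^ (n - 1) / (a * (real n - 1))) (at s)"
  unfolding k_def[abs_def] using n1 a_pos by (auto intro!: derivative_eq_intros V_deriv)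

text \<open>The derivative of the summand with r^n cancels \<open>r1\<close> times the derivative of
  \<open>k c\<close>; only the derivative of \<open>r1\<close> times \<open>k c\<close>
  survives.\<close>

lemma lam_deriv: "(lam c has_real_derivative lam1 c s) (at s)"
proof -
  have "((\<lambda>s. r s ^ n) has_real_derivative real n * r s ^ (n - 1) * r1 s) (at s)"
    by (auto intro!: derivative_eq_intros r_deriv)
  from DERIV_add[OF DERIV_cdivide[OF this] DERIV_mult[OF r1_deriv k_deriv]]
  show ?thesis
    unfolding lam_def[abs_def] lam1_def by (rule DERIV_cong) simp
qed

lemma r2_deriv: "(r2 has_real_derivative - (real n - 1) * (r2 s / r s) * r1 s) (at s)"
proof -
  have "((\<lambda>s. r s ^ (n - 1)) has_real_derivative real (n - 1) * r s ^ (n - 2) * r1 s) (at s)"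
    by (rule DERIV_cong[OF DERIV_power[OF r_deriv]]) (use n in \<open>simp add: numeral_2_eq_2\<close>)
  moreover have "n - 1 = Suc (n - 2)" "real (n - 1) = real n - 1" using n by auto
  then have "r s ^ (n - 1) = r s * r s ^ (n - 2)" "real (n - 1) = real n - 1" by simp_all
  ultimately have "((\<lambda>s. r s ^ (n - 1)) has_real_derivative (real n - 1) * r s ^ (n - 2) * r1 s) (at s)"
    and pw: "r s ^ (n - 1) = r s * r s ^ (n - 2)" by simp_all
  moreover have "r s ^ (n - 1) \<noteq> 0" using r_pos[of s] by simp
  ultimately have "((\<lambda>s. a / r s ^ (n - 1)) has_real_derivative
      (0 * r s ^ (n - 1) - a * ((real n - 1) * r s ^ (n - 2) * r1 s)) / (r s ^ (n - 1) * r s ^ (n - 1))) (at s)"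
    by (intro DERIV_divide DERIV_const)
  then show ?thesis
    unfolding r2_def[abs_def]
    by (rule DERIV_cong) (unfold pw, use r_pos[of s] in \<open>simp add: field_simps\<close>)
qed

text \<open>As \<open>r2\<close> times r^(n - 1) is \<open>a\<close>, the derivative of
  \<open>k c\<close> contributes the constant - n / (n - 1) = - 1 - 1 / (n - 1). The - 1 is exactly
  what the r^n part of \<open>lam c\<close> contributes to - (n - 1) (r'' / r) \<lambda>.\<close>

lemma lam1_deriv: "(lam1 c has_real_derivative lam2 c s) (at s)"
proof -
  have r: "r s > 0" by (rule r_pos)
  have A: "real n - 1 \<noteq> 0" "a \<noteq> 0" using n1 a_pos by auto
  have r2n: "r2 s * r s ^ (n - 1) = a" using r by (simp add: r2_def)
  have "(lam1 c has_real_derivative (- (real n - 1) * (r2 s / r s) * r1 s) * k c s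
      + (- real n * r s ^ (n - 1) / (a * (real n - 1))) * r2 s) (at s)"
    unfolding lam1_def[abs_def] by (rule DERIV_mult[OF r2_deriv k_deriv])
  also have "(- real n * r s ^ (n - 1) / (a * (real n - 1))) * r2 s = - real n * (r2 s * r s ^ (n - 1)) / (a * (real n - 1))"
    by simp
  also have "\<dots> = - real n / (real n - 1)"
    unfolding r2n using A by simp
  also have "(- (real n - 1) * (r2 s / r s) * r1 s) * k c s + \<dots> = lam2 c s"
  proof -
    have "(real n - 1) * (r2 s / r s) * (r s ^ n / (a * (real n - 1))) = (r2 s * r s ^ n) / (r s * a)"
      using A by simp
    also have "\<dots> = 1" unfolding r2_r using A r by simp
    finally have "lam2 c s = - 1 / (real n - 1) - 1 - (real n - 1) * (r2 s / r s) * r1 s * k c s"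
      by (simp add: lam2_def lam_def algebra_simps)
    moreover have "real n / (real n - 1) = 1 + 1 / (real n - 1)" using A by (simp add: field_simps)
    moreover have "(- (real n - 1) * (r2 s / r s) * r1 s) * k c s = - ((real n - 1) * (r2 s / r s) * r1 s * k c s)"
      by (simp only: mult_minus_left)
    moreover have "- real n / (real n - 1) = - (real n / (real n - 1))" by simp
    ultimately show ?thesis by linarith
  qed
  finally show ?thesis .
qed

lemma radial_equation: "r1 s * lam1 c s - r2 s * lam c s = - r s / (real n - 1)"
proof -
  have "r1 s * lam1 c s - r2 s * lam c s = - (r2 s * r s ^ n) / (a * (real n - 1))"
    by (simp add: lam_def lam1_def algebra_simps)
  then show ?thesis using a_pos by (simp add: r2_r)
qed

text \<open>The radial equation expresses the term with \<open>lam1\<close>, and the first integral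
  the curvature term, through (r'' / r) \<lambda>; \<open>lam2\<close> has this form by
  definition.\<close>

lemma spherical_equation:
  "lam2 c s + (real n - 2) * (r1 s / r s) * lam1 c s
    + lam c s * ((real n - 2) * (1 - (r1 s)\<^sup>2) / (r s)\<^sup>2 - r2 s / r s) = - 1"
proof -
  have r: "r s > 0" by (rule r_pos)
  have "r1 s / r s * lam1 c s = r2 s / r s * lam c s - 1 / (real n - 1)"
  proof -
    have "r1 s * lam1 c s = r2 s * lam c s - r s / (real n - 1)" using radial_equation[of s c] by simp
    then show ?thesis using r by (simp add: diff_divide_distrib)
  qed
  then have "(real n - 2) * (r1 s / r s) * lam1 c s = (real n - 2) * (r2 s / r s * lam c s - 1 / (real n - 1))"
    by (simp only: mult.assoc)
  moreover have "lam c s * (2 * r2 s / r s - r2 s / r s) = r2 s / r s * lam c s"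
    using r by (simp add: field_simps)
  \<comment> \<open>Here q = n - 1 and x = (r'' / r) \<lambda>; the coefficients of x add up to 0
    and the constants to - 1.\<close>
  moreover have "- 1 / q - q * x + (q - 1) * (x - 1 / q) + x = - 1" if "q > 0" for q x :: real
    using that by (simp add: field_simps)
  from this[OF n1(1), of "r2 s / r s * lam c s"]
  have "lam2 c s + (real n - 2) * (r2 s / r s * lam c s - 1 / (real n - 1)) + r2 s / r s * lam c s = - 1"
    by (simp add: lam2_def mult.assoc)
  ultimately show ?thesis unfolding first_integral_r2 by presburger
qed

lemma lam_0: "lam c 0 > 0"
  using n1 a_pos r_pos[of 0] by (simp add: lam_def r1_0)

lemma lam2_neg: "lam c s > 0 \<Longrightarrow> lam2 c s \<le> - (1 / (real n - 1))"
  using n1 r2_pos[of s] r_pos[of s] by (simp add: lam2_def)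

lemma lam_zero_pos: "\<exists>s>0. lam c s = 0"
  by (rule exists_zero_if_concave_while_pos[OF lam_deriv lam1_deriv lam2_neg lam_0]) (use n1 in auto)

text \<open>For c \<noteq> 0 the solution is not even, so this zero is not the mirror image of a
  positive one; the concavity argument is applied to the reflected function.\<close>

lemma lam_zero_neg: "\<exists>s<0. lam c s = 0"
proof -
  have "\<exists>t>0. lam c (- t) = 0"
  proof (rule exists_zero_if_concave_while_pos[where g="\<lambda>t. lam c (- t)" and g'="\<lambda>t. - lam1 c (- t)" and g''="\<lambda>t. lam2 c (- t)"])
    show "((\<lambda>t. lam c (- t)) has_real_derivative - lam1 c (- t)) (at t)" for t
      by (rule DERIV_mirror[THEN iffD1, OF lam_deriv])
    show "((\<lambda>t. - lam1 c (- t)) has_real_derivative lam2 c (- t)) (at t)" for t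
      using DERIV_minus[OF DERIV_mirror[THEN iffD1, OF lam1_deriv]] by simp
  qed (use n1 lam2_neg lam_0 in auto)
  then show ?thesis by (metis neg_less_0_iff_less)
qed

lemma lam_prescribed_zero: "s \<noteq> 0 \<Longrightarrow> \<exists>c. lam c s = 0"
proof -
  assume "s \<noteq> 0"
  then have "r1 s \<noteq> 0" using r1_pos[of s] r1_neg[of s] by (metis linorder_less_linear order_less_irrefl)
  moreover have "lam (- lam 0 s / r1 s) s = lam 0 s + (- lam 0 s / r1 s) * r1 s"
    by (simp add: lam_def k_def algebra_simps)
  ultimately have "lam (- lam 0 s / r1 s) s = 0" by simp
  then show ?thesis by blast
qed

lemma lam_even: "lam 0 (- s) = lam 0 s"
  by (simp add: lam_def k_def r_even r1_odd V_odd)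

lemma Ck_on_lam: "Ck_on m UNIV (lam c)"
proof -
  have "Ck_on m UNIV (\<lambda>s. r s ^ (n - 1))"
    using Ck_on_power[OF open_UNIV] Ck_on_r_r1 by blast
  then have "Ck_on (Suc m) UNIV V"
    by (rule Ck_on_real_Suc[OF open_UNIV V_deriv])
  then have "Ck_on m UNIV V" by (rule Ck_on_SucD(3)[OF open_UNIV])
  moreover have eq: "lam c s = inverse (a * (real n - 1)) * r s ^ n
      + r1 s * (c - real n * inverse (a * (real n - 1)) * V s)" for s
    by (simp add: lam_def k_def divide_inverse)
  ultimately show ?thesis
    using Ck_on_r_r1[of m] unfolding ext[of "lam c", OF eq]
    by (intro Ck_on_add Ck_on_diff Ck_on_mult Ck_on_const Ck_on_power open_UNIV) auto
qed

end

section \<open>Charts\<close>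

definition stereo_inv :: "'a::euclidean_space \<Rightarrow> real \<times> 'a \<Rightarrow> 'a" where
  "stereo_inv w p = fst p *\<^sub>R w + (1 / (1 - snd p \<bullet> w)) *\<^sub>R tproj w (snd p)"

lemma fst_stereo_par [simp]: "fst (stereo_par u x) = x \<bullet> u"
  by (simp add: stereo_par_eq)

lemma norm_snd_stereo_par:
  assumes "norm u = 1"
  shows "norm (snd (stereo_par u x)) = 1"
proof -
  have uu: "u \<bullet> u = 1" using assms by (simp add: norm_eq_1)
  have "snd (stereo_par u x) \<bullet> snd (stereo_par u x)
      = cfac u x * (cfac u x * (tproj u x \<bullet> tproj u x)) + (1 - cfac u x)\<^sup>2"
    using assms uu by (simp add: stereo_par_eq inner_add_left inner_add_right power2_eq_square)
  also have "\<dots> = 1"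
    unfolding cfac_norm by (simp add: power2_eq_square algebra_simps)
  finally show ?thesis by (simp add: norm_eq_1)
qed

lemma snd_stereo_par_pole: "norm u = 1 \<Longrightarrow> snd (stereo_par u x) \<bullet> u = 1 - cfac u x"
  by (simp add: stereo_par_eq inner_add_left norm_eq_1)

lemma snd_stereo_par_pole_less: "norm u = 1 \<Longrightarrow> snd (stereo_par u x) \<bullet> u < 1"
  using cfac_pos[of u x] by (simp add: snd_stereo_par_pole)

lemma stereo_inv_stereo_par:
  assumes "norm u = 1"
  shows "stereo_inv u (stereo_par u x) = x"
  using cfac_pos[of u x] assms tproj_decomp[of x u, symmetric]
  by (simp add: stereo_inv_def snd_stereo_par_pole) (simp add: stereo_par_eq)

lemma inj_stereo_par: "norm u = 1 \<Longrightarrow> inj (stereo_par u)"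
  by (metis injI stereo_inv_stereo_par)

lemma stereo_par_stereo_inv:
  assumes "norm u = 1" "norm (snd p) = 1" "snd p \<bullet> u \<noteq> 1"
  shows "stereo_par u (stereo_inv u p) = p"
proof -
  define t where "t = snd p \<bullet> u"
  have t: "1 - t \<noteq> 0" using assms(3) by (simp add: t_def)
  have uu: "u \<bullet> u = 1" "snd p \<bullet> snd p = 1" using assms by (simp_all add: norm_eq_1)
  have y: "tproj u (stereo_inv u p) = (1 / (1 - t)) *\<^sub>R tproj u (snd p)"
    using assms by (simp add: stereo_inv_def t_def)
  have "tproj u (snd p) \<bullet> tproj u (snd p) = 1 - t\<^sup>2"
    using uu by (simp add: tproj_def inner_diff_left inner_diff_right t_def inner_commute power2_eq_square)
  then have "(norm (tproj u (stereo_inv u p)))\<^sup>2 = (1 - t\<^sup>2) / (1 - t)\<^sup>2"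
    unfolding y norm_scaleR power_mult_distrib power2_norm_eq_inner by (simp add: power_divide)
  also have "1 - t\<^sup>2 = (1 + t) * (1 - t)"
    by (simp add: algebra_simps power2_eq_square)
  also have "\<dots> / (1 - t)\<^sup>2 = (1 + t) / (1 - t)"
    using t by (simp add: power2_eq_square)
  finally have "1 + (norm (tproj u (stereo_inv u p)))\<^sup>2 = 2 / (1 - t)"
    using t by (simp add: field_simps)
  then have c: "cfac u (stereo_inv u p) = 1 - t"
    by (simp add: cfac_def)
  have "stereo_inv u p \<bullet> u = fst p"
    using assms uu by (simp add: stereo_inv_def inner_add_left)
  then show ?thesis
    using t by (simp add: stereo_par_eq c y prod_eq_iff) (simp add: t_def tproj_def)
qed

lemma isCont_stereo_par: "isCont (stereo_par u) x"
  by (rule has_derivative_continuous[OF has_derivative_stereo_par])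

lemma continuous_on_stereo_par: "continuous_on S (stereo_par u)"
  by (simp add: continuous_at_imp_continuous_on isCont_stereo_par)

lemma continuous_on_cfac: "continuous_on S (cfac u)"
  by (simp add: continuous_at_imp_continuous_on has_derivative_continuous[OF has_derivative_cfac])

lemma open_below_pole: "open {p :: real \<times> 'a::euclidean_space. snd p \<bullet> u < c}"
  by (intro open_Collect_less continuous_intros)

lemma continuous_on_stereo_inv: "continuous_on {p. snd p \<bullet> u < 1} (stereo_inv u)"
  unfolding stereo_inv_def tproj_def by (intro continuous_intros) auto

text \<open>Over the unit sphere, c = 1 removes only the pole \<open>u\<close>, while c = 0 leaves
  the open hemisphere facing away from it.\<close>

definition cap :: "'a::euclidean_space \<Rightarrow> real \<Rightarrow> (real \<times> 'a) set \<Rightarrow> (real \<times> 'a) set" where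
  "cap u c \<Omega> = {p\<in>\<Omega>. snd p \<bullet> u < c}"

context
  fixes u :: "'a::euclidean_space" and c :: real and \<Omega> :: "(real \<times> 'a) set"
  assumes u: "norm u = 1" and c: "c \<le> 1" and \<Omega>: "\<Omega> \<subseteq> UNIV \<times> sphere 0 1"
begin

lemma stereo_par_image_cap: "stereo_par u ` (stereo_par u -` cap u c \<Omega>) = cap u c \<Omega>"
proof -
  have "p \<in> range (stereo_par u)" if "p \<in> cap u c \<Omega>" for p
  proof -
    have "norm (snd p) = 1" "snd p \<bullet> u \<noteq> 1" using that \<Omega> c by (auto simp: cap_def)
    then show ?thesis using stereo_par_stereo_inv[OF u] by (metis rangeI)
  qed
  then show ?thesis by blast
qed

lemma open_map_stereo_par: "open_map (top_of_set (stereo_par u -` cap u c \<Omega>)) (top_of_set \<Omega>) (stereo_par u)"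
  unfolding open_map_def
proof (intro allI impI)
  fix U assume "openin (top_of_set (stereo_par u -` cap u c \<Omega>)) U"
  then obtain T where T: "open T" "U = stereo_par u -` cap u c \<Omega> \<inter> T"
    by (auto simp: openin_open)
  \<comment> \<open>The image is a preimage under \<open>stereo_inv u\<close>; the first set is the
    region off the pole where that inverse is continuous.\<close>
  let ?O = "{p. snd p \<bullet> u < 1} \<inter> stereo_inv u -` T \<inter> {p. snd p \<bullet> u < c}"
  have "open ?O"
    by (intro open_Int continuous_open_preimage continuous_on_stereo_inv open_below_pole T)
  moreover have "stereo_par u ` U = \<Omega> \<inter> ?O"
  proof
    show "stereo_par u ` U \<subseteq> \<Omega> \<inter> ?O"
      using c by (auto simp: T cap_def stereo_inv_stereo_par[OF u] snd_stereo_par_pole_less[OF u])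
    show "\<Omega> \<inter> ?O \<subseteq> stereo_par u ` U"
    proof
      fix p assume p: "p \<in> \<Omega> \<inter> ?O"
      then have "stereo_par u (stereo_inv u p) = p"
        using \<Omega> by (intro stereo_par_stereo_inv u) auto
      then show "p \<in> stereo_par u ` U"
        using p by (intro image_eqI[of _ _ "stereo_inv u p"]) (auto simp: T cap_def)
    qed
  qed
  ultimately show "openin (top_of_set \<Omega>) (stereo_par u ` U)"
    by (auto simp: openin_open)
qed

lemma continuous_map_stereo_par:
  "continuous_map (top_of_set (stereo_par u -` cap u c \<Omega>)) (top_of_set \<Omega>) (stereo_par u)"
  using continuous_on_stereo_par[of _ u] by (auto simp: cap_def)

end

text \<open>The height is the linear function \<open>x \<bullet> u\<close> of the coordinates, so
  slices become parallel hyperplanes. The cap condition reads \<open>1 - cfac u x < c\<close>; being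
  open, it adds no boundary.\<close>

lemma half_space_like_stereo_slab:
  fixes u :: "'a::euclidean_space"
  assumes "norm u = 1" "\<alpha> < \<beta>"
  shows "half_space_like (stereo_par u -` cap u c ({\<alpha>..\<beta>} \<times> sphere 0 1))" (is "half_space_like ?D")
    and "stereo_par u -` cap u c ({\<alpha>..\<beta>} \<times> sphere 0 1) - interior (stereo_par u -` cap u c ({\<alpha>..\<beta>} \<times> sphere 0 1))
      \<subseteq> {x. x \<bullet> u = \<alpha> \<or> x \<bullet> u = \<beta>}"
proof -
  define W where "W = {x. 1 - cfac u x < c}"
  have W: "open W"
    unfolding W_def by (intro open_Collect_less continuous_intros continuous_on_cfac)
  have D: "?D = {x\<in>W. \<alpha> \<le> x \<bullet> u \<and> x \<bullet> u \<le> \<beta>}"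
  proof -
    have "stereo_par u x = (x \<bullet> u, snd (stereo_par u x))" for x
      by (simp add: prod_eq_iff)
    then show ?thesis
      using norm_snd_stereo_par[OF assms(1)] 
      by (auto simp: cap_def W_def snd_stereo_par_pole[OF assms(1)] mem_Times_iff)
  qed
  show "half_space_like ?D"
    unfolding D using assms by (intro half_space_like_slab W) auto
  have "open (W \<inter> ({x. u \<bullet> x > \<alpha>} \<inter> {x. u \<bullet> x < \<beta>}))"
    by (intro open_Int W open_halfspace_gt open_halfspace_lt)
  then have "W \<inter> ({x. u \<bullet> x > \<alpha>} \<inter> {x. u \<bullet> x < \<beta>}) \<subseteq> interior ?D"
    by (rule interior_maximal[rotated]) (auto simp: D inner_commute[of _ u])
  moreover have "?D \<subseteq> W \<inter> {x. \<alpha> \<le> x \<bullet> u \<and> x \<bullet> u \<le> \<beta>}" by (auto simp: D)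
  ultimately have "?D - interior ?D \<subseteq> W \<inter> {x. \<alpha> \<le> x \<bullet> u \<and> x \<bullet> u \<le> \<beta>} - W \<inter> ({x. u \<bullet> x > \<alpha>} \<inter> {x. u \<bullet> x < \<beta>})"
    by blast
  also have "\<dots> \<subseteq> {x. x \<bullet> u = \<alpha> \<or> x \<bullet> u = \<beta>}"
    by (auto simp: inner_commute[of _ u])
  finally show "?D - interior ?D \<subseteq> {x. x \<bullet> u = \<alpha> \<or> x \<bullet> u = \<beta>}" .
qed

section \<open>Smooth coordinate expressions and isometric coordinate changes\<close>

lemma Ck_on_cfac:
  assumes "open U"
  shows "Ck_on k U (cfac u)"
proof -
  have "1 + tproj u x \<bullet> tproj u x \<noteq> 0" for x
    by (metis add_pos_nonneg inner_ge_zero less_numeral_extra(1) less_irrefl)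
  then have "Ck_on k U (\<lambda>x. 2 / (1 + tproj u x \<bullet> tproj u x))"
    by (intro Ck_on_divide Ck_on_add Ck_on_const Ck_on_inner Ck_on_bounded_linear bounded_linear_tproj assms)
  then show ?thesis
    by (simp add: cfac_def[abs_def] power2_norm_eq_inner)
qed

lemma Ck_on_height: "open U \<Longrightarrow> Ck_on k U (\<lambda>x. x \<bullet> u)"
  by (intro Ck_on_bounded_linear bounded_linear_inner_left)

lemma Ck_on_snd_stereo_par: "open U \<Longrightarrow> Ck_on k U (\<lambda>x. snd (stereo_par u x))"
  unfolding stereo_par_eq snd_conv
  by (intro Ck_on_add Ck_on_diff Ck_on_const Ck_on_scaleR Ck_on_cfac Ck_on_bounded_linear bounded_linear_tproj)

lemma riemannian_chartI:
  assumes u: "norm u = 1" and cmet: "cmet c = cmet (stereo_chart r u)"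
    and r: "\<And>k. Ck_on k UNIV r" "\<And>s. r s > 0"
    and top: "half_space_like (cdom c)" "embedding_map (top_of_set (cdom c)) T (cpar c)"
      "openin T (cpar c ` cdom c)"
  shows "riemannian_chart T c"
proof -
  have "smooth_on (cdom c) (\<lambda>x. cmet c x v w)" for v w
  proof (rule smooth_onI[OF open_UNIV])
    show "Ck_on k UNIV (\<lambda>x. (v \<bullet> u) * (w \<bullet> u) + (r (x \<bullet> u) * cfac u x)\<^sup>2 * (tproj u v \<bullet> tproj u w))" for k
      by (intro Ck_on_add Ck_on_mult Ck_on_power Ck_on_const Ck_on_cfac Ck_on_compose_real[OF open_UNIV r(1)]
          Ck_on_height open_UNIV)
  qed (simp_all add: cmet cmet_stereo_chart[OF u])
  moreover have "bilinear (cmet c x)" for x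
    by (simp add: bilinear_def linear_iff cmet cmet_stereo_chart[OF u] inner_add_left inner_add_right algebra_simps)
  moreover have "cmet c x v w = cmet c x w v" for x v w
    by (simp add: cmet cmet_stereo_chart[OF u] inner_commute)
  moreover have "cmet c x v v > 0" if "v \<noteq> 0" for x v
  proof (cases "tproj u v = 0")
    case True
    then have "v \<bullet> u \<noteq> 0" using that tproj_decomp[of v u] by auto
    then show ?thesis by (simp add: cmet cmet_stereo_chart[OF u] True) (metis not_real_square_gt_zero)
  next
    case False
    have "(r (x \<bullet> u) * cfac u x)\<^sup>2 > 0"
      using r(2)[of "x \<bullet> u"] cfac_pos[of u x] by simp
    then show ?thesis using False by (simp add: cmet cmet_stereo_chart[OF u] add_nonneg_pos)
  qed
  ultimately show ?thesis using top unfolding riemannian_chart_def by blast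
qed

text \<open>The coordinate change from pole \<open>u\<close> to pole \<open>w\<close>, composed with \<open>p \<mapsto> -p\<close> if \<open>\<sigma> = -1\<close>.
  It is an isometry because \<open>stereo_par w\<close> maps it to \<open>\<sigma> stereo_par u\<close>.\<close>

definition stereo_trans :: "real \<Rightarrow> 'a::euclidean_space \<Rightarrow> 'a \<Rightarrow> 'a \<Rightarrow> 'a" where
  "stereo_trans \<sigma> u w x = stereo_inv w (\<sigma> *\<^sub>R stereo_par u x)"

context
  fixes u w :: "'a::euclidean_space" and \<sigma> :: real
  assumes u: "norm u = 1" and w: "norm w = 1" and \<sigma>: "\<bar>\<sigma>\<bar> = 1"
begin

definition trans_dom where "trans_dom = {x. \<sigma> * (snd (stereo_par u x) \<bullet> w) < 1}"

lemma open_trans_dom: "open trans_dom"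
  unfolding trans_dom_def
  by (intro open_Collect_less continuous_intros continuous_on_stereo_par)

lemma Ck_on_stereo_trans: "Ck_on k trans_dom (stereo_trans \<sigma> u w)"
proof -
  have "Ck_on k trans_dom (\<lambda>x. (\<sigma> * (x \<bullet> u)) *\<^sub>R w + (1 / (1 - \<sigma> * (snd (stereo_par u x) \<bullet> w))) *\<^sub>R
      (\<sigma> *\<^sub>R (snd (stereo_par u x)) - (\<sigma> * (snd (stereo_par u x) \<bullet> w)) *\<^sub>R w))"
    using open_trans_dom
    by (intro Ck_on_add Ck_on_scaleR Ck_on_mult Ck_on_const Ck_on_height Ck_on_divide Ck_on_diff Ck_on_inner
        Ck_on_snd_stereo_par) (auto simp: trans_dom_def)
  then show ?thesis
    by (simp add: stereo_trans_def[abs_def] stereo_inv_def tproj_def)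
qed

lemma stereo_par_stereo_trans:
  assumes "x \<in> trans_dom"
  shows "stereo_par w (stereo_trans \<sigma> u w x) = \<sigma> *\<^sub>R stereo_par u x"
  unfolding stereo_trans_def
  using assms \<sigma> norm_snd_stereo_par[OF u, of x] by (intro stereo_par_stereo_inv w) (auto simp: trans_dom_def)

lemma stereo_trans_isometry:
  assumes "x \<in> trans_dom" and r: "\<And>s. r (\<sigma> * s) = r s"
    and F': "(stereo_trans \<sigma> u w has_derivative F') (at x)"
  shows "cmet (stereo_chart r w) (stereo_trans \<sigma> u w x) (F' v1) (F' v2) = cmet (stereo_chart r u) x v1 v2"
proof -
  let ?F = "stereo_trans \<sigma> u w"
  have dw: "(stereo_par w has_derivative frechet_derivative (stereo_par w) (at y)) (at y)" for y w :: 'a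
    using has_derivative_stereo_par frechet_derivative_works differentiable_def by blast
  \<comment> \<open>The same map is differentiated by the chain rule and, being \<sigma> times
    \<open>stereo_par u\<close>, directly. The sign drops out of the metric because its square is
    1.\<close>
  have "((\<lambda>x. stereo_par w (?F x)) has_derivative
      (\<lambda>v. frechet_derivative (stereo_par w) (at (?F x)) (F' v))) (at x)"
    by (rule has_derivative_compose[OF F' dw])
  moreover have "((\<lambda>x. stereo_par w (?F x)) has_derivative
      (\<lambda>v. \<sigma> *\<^sub>R frechet_derivative (stereo_par u) (at x) v)) (at x)"
    by (rule has_derivative_transform_within_open[OF has_derivative_scaleR_right[OF dw] open_trans_dom assms(1)])
       (simp add: stereo_par_stereo_trans)
  ultimately have D: "frechet_derivative (stereo_par w) (at (?F x)) (F' v) = \<sigma> *\<^sub>R frechet_derivative (stereo_par u) (at x) v" for v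
    using has_derivative_unique by (metis (no_types, lifting))
  have \<sigma>2: "\<sigma> * (\<sigma> * t) = t" for t
    using \<sigma> abs_mult_self_eq[of \<sigma>] by (simp add: mult.assoc[symmetric])
  have \<sigma>3: "(\<sigma> * s) * (\<sigma> * t) = s * t" for s t
    by (metis \<sigma>2 mult.assoc mult.left_commute)
  have "r (stereo_trans \<sigma> u w x \<bullet> w) = r (x \<bullet> u)"
    using arg_cong[OF stereo_par_stereo_trans[OF assms(1)], of fst] r by simp
  then show ?thesis
    by (simp add: stereo_chart_def warped_metric_def D \<sigma>2 \<sigma>3)
qed

end

text \<open>The sign is allowed to depend on the point: in the antipodal quotient a coordinate
  change may fix the Schwarzschild point on one piece of the overlap and send p to - p on
  another.\<close>

lemma compatible_chartsI:
  fixes c d :: "('a::euclidean_space, 'p) rchart"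
  assumes u: "norm u = 1" and w: "norm w = 1"
    and c: "cmet c = cmet (stereo_chart r u)" and d: "cmet d = cmet (stereo_chart r w)"
    and hs: "half_space_like (overlap c d)"
    and loc: "\<And>x. x \<in> overlap c d \<Longrightarrow> \<exists>\<sigma> U. \<bar>\<sigma>\<bar> = 1 \<and> (\<forall>s. r (\<sigma> * s) = r s) \<and> open U \<and> x \<in> U \<and> U \<subseteq> trans_dom u w \<sigma>
        \<and> (\<forall>y\<in>U \<inter> overlap c d. transition c d y = stereo_trans \<sigma> u w y)"
  shows "compatible_charts c d"
  unfolding compatible_charts_def
proof (intro conjI ballI allI)
  show "smooth_on (overlap c d) (transition c d)"
    unfolding smooth_on_def
  proof
    fix x assume "x \<in> overlap c d"
    from loc[OF this] obtain \<sigma> U where *: "\<bar>\<sigma>\<bar> = 1" "open U" "x \<in> U" "U \<subseteq> trans_dom u w \<sigma>"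
      "\<forall>y\<in>U \<inter> overlap c d. transition c d y = stereo_trans \<sigma> u w y" by blast
    have "\<forall>k. Ck_on k (trans_dom u w \<sigma>) (stereo_trans \<sigma> u w)"
      using Ck_on_stereo_trans[OF u w *(1)] by blast
    then have "\<forall>k. Ck_on k U (stereo_trans \<sigma> u w)"
      using Ck_on_subset *(4) by blast
    then show "\<exists>U F. open U \<and> x \<in> U \<and> (\<forall>k. Ck_on k U F) \<and> (\<forall>y\<in>U \<inter> overlap c d. F y = transition c d y)"
      using * by metis
  qed
  fix x v1 v2 assume x: "x \<in> overlap c d"
  from loc[OF this] obtain \<sigma> U where *: "\<bar>\<sigma>\<bar> = 1" "\<forall>s. r (\<sigma> * s) = r s" "open U" "x \<in> U" "U \<subseteq> trans_dom u w \<sigma>"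
      "\<forall>y\<in>U \<inter> overlap c d. transition c d y = stereo_trans \<sigma> u w y" by blast
  have xd: "x \<in> trans_dom u w \<sigma>" using * by blast
  obtain F' where F': "(stereo_trans \<sigma> u w has_derivative F') (at x)"
    using Ck_on_SucD(1)[OF open_trans_dom[OF u w *(1)] Ck_on_stereo_trans[OF u w *(1)] xd] by blast
  have "dder (overlap c d) (transition c d) x v = F' v" for v
    by (rule dder_eqI[OF hs x F' *(3,4)]) (use *(6) in auto)
  moreover have "transition c d x = stereo_trans \<sigma> u w x" using * x by blast
  ultimately show "cmet c x v1 v2 = cmet d (transition c d x)
          (dder (overlap c d) (transition c d) x v1) (dder (overlap c d) (transition c d) x v2)"
    using stereo_trans_isometry[OF u w *(1) xd _ F'] *(2) by (simp add: c d)
qed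

section \<open>Critical metrics on slabs and their quotients\<close>

lemma second_countable_euclidean: "second_countable (euclidean :: 'a::second_countable_topology topology)"
proof -
  obtain B :: "'a set set" where B: "countable B" "\<And>C. C \<in> B \<Longrightarrow> open C" "\<And>S. open S \<Longrightarrow> \<exists>U. U \<subseteq> B \<and> S = \<Union>U"
    using univ_second_countable by blast
  have "\<exists>V\<in>B. x \<in> V \<and> V \<subseteq> U" if "open U" "x \<in> U" for U x
    using B(3)[OF that(1)] that(2) by blast
  then show ?thesis
    unfolding second_countable_def using B(1,2) by (intro exI[of _ B]) auto
qed

context schwarzschild_radial
begin

lemma warped_stereo: "norm u = 1 \<Longrightarrow> warped_stereo r r1 r2 u"
  by unfold_locales (auto intro: r_pos r_deriv r1_deriv)

lemma critical_equation_stereo: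
  fixes u :: "'a::euclidean_space"
  assumes n_eq: "n = DIM('a)" and u: "norm u = 1" and D: "half_space_like D"
    and f: "\<And>x. x \<in> D \<Longrightarrow> f x = lam c (x \<bullet> u)" and x: "x \<in> D"
  shows "- laplacian D (cmet (stereo_chart r u)) f x * cmet (stereo_chart r u) x v w
    + hessian D (cmet (stereo_chart r u)) f x v w - f x * ricci D (cmet (stereo_chart r u)) x v w
    = cmet (stereo_chart r u) x v w"
  by (rule warped_stereo.critical_equation_radial[OF warped_stereo[OF u] D lam_deriv lam1_deriv f x refl])
     (use radial_equation[of _ c] spherical_equation[of c] n1 in \<open>simp_all add: n_eq\<close>)

lemma smooth_on_lam_height: "smooth_on D (\<lambda>x. lam c (x \<bullet> u))"
  by (rule smooth_onI[OF open_UNIV _ Ck_on_compose_real[OF open_UNIV Ck_on_lam Ck_on_height]]) auto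

lemma critical_on_schwarzschild:
  assumes "n = DIM('a::euclidean_space)"
  shows "\<exists>f. smooth_function (schwarzschild r :: ('a, real \<times> 'a) rmanifold) f \<and>
    critical_equation (schwarzschild r :: ('a, real \<times> 'a) rmanifold) f"
proof (intro exI[of _ "\<lambda>p. lam 0 (fst p)"] conjI)
  show "smooth_function (schwarzschild r :: ('a, real \<times> 'a) rmanifold) (\<lambda>p. lam 0 (fst p))"
    by (auto simp: smooth_function_def schwarzschild_def stereo_chart_def comp_def intro: smooth_on_lam_height)
  show "critical_equation (schwarzschild r :: ('a, real \<times> 'a) rmanifold) (\<lambda>p. lam 0 (fst p))"
    unfolding critical_equation_def
  proof (intro ballI allI)
    fix ch :: "('a, real \<times> 'a) rchart" and x v w
    assume "ch \<in> atlas (schwarzschild r)"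
    then obtain u where u: "norm u = 1" "ch = stereo_chart r u"
      by (auto simp: schwarzschild_def)
    have ch: "cdom ch = UNIV" "cpar ch = stereo_par u"
      by (simp_all add: u stereo_chart_def)
    show "- laplacian (cdom ch) (cmet ch) ((\<lambda>p. lam 0 (fst p)) \<circ> cpar ch) x * cmet ch x v w
       + hessian (cdom ch) (cmet ch) ((\<lambda>p. lam 0 (fst p)) \<circ> cpar ch) x v w
       - lam 0 (fst (cpar ch x)) * ricci (cdom ch) (cmet ch) x v w = cmet ch x v w"
      using critical_equation_stereo[OF assms u(1) half_space_like_open[OF open_UNIV],
          of "(\<lambda>p. lam 0 (fst p)) \<circ> cpar ch" 0 x v w]
      by (simp add: ch) (simp add: u)
  qed
qed

end

text \<open>The quotient of the slab \<open>\<Omega> = [\<alpha>, \<beta>] \<times> S\<^sup>n\<^sup>-\<^sup>1\<close> by a group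
  \<open>S \<subseteq> {1, -1}\<close> of signs.  The closed domain in (ii) is the case \<open>S = {1}\<close>, \<open>c = 1\<close>, with
  the full stereographic charts; the antipodal quotient in (iii) is the double of the domain
  modulo \<open>S = {1, -1}\<close>, with \<open>c = 0\<close> restricting the charts to hemispheres.\<close>

locale slab_quotient = schwarzschild_radial n a r for n a r +
  fixes \<alpha> \<beta> c :: real and S :: "real set"
    and \<pi> :: "real \<times> 'a::euclidean_space \<Rightarrow> 'p" and X :: "('a, 'p) rmanifold"
    and \<Omega> :: "(real \<times> 'a) set"
  assumes n_eq: "n = DIM('a)" and \<alpha>\<beta>: "\<alpha> < \<beta>" and c: "0 \<le> c" "c \<le> 1"
    and \<Omega>: "\<Omega> = {\<alpha>..\<beta>} \<times> sphere 0 1"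
    and S: "1 \<in> S" "S \<subseteq> {1, -1}" and S_neg: "-1 \<in> S \<Longrightarrow> \<alpha> = - \<beta> \<and> c = 0"
    and cont: "continuous_map (top_of_set \<Omega>) (mtop X) \<pi>"
    and opn: "open_map (top_of_set \<Omega>) (mtop X) \<pi>"
    and surj: "\<pi> ` \<Omega> = topspace (mtop X)"
    and \<pi>_eq: "\<And>p q. p \<in> \<Omega> \<Longrightarrow> q \<in> \<Omega> \<Longrightarrow> \<pi> p = \<pi> q \<longleftrightarrow> (\<exists>\<sigma>\<in>S. q = \<sigma> *\<^sub>R p)"
    and atlas: "atlas X = (\<lambda>u. \<lparr>cdom = stereo_par u -` cap u c \<Omega>, cpar = (\<lambda>x. \<pi> (stereo_par u x)),
        cmet = cmet (stereo_chart r u)\<rparr>) ` sphere 0 1"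
begin

definition C where
  "C u = \<lparr>cdom = stereo_par u -` cap u c \<Omega>, cpar = (\<lambda>x. \<pi> (stereo_par u x)), cmet = cmet (stereo_chart r u)\<rparr>"

lemma C_simps [simp]:
  "cdom (C u) = stereo_par u -` cap u c \<Omega>"
  "cpar (C u) = (\<lambda>x. \<pi> (stereo_par u x))"
  "cmet (C u) = cmet (stereo_chart r u)"
  by (simp_all add: C_def)

lemma atlas_eq: "atlas X = C ` sphere 0 1"
  by (simp add: atlas C_def[abs_def])

lemma \<Omega>_subset: "\<Omega> \<subseteq> UNIV \<times> sphere 0 1"
  by (auto simp: \<Omega>)

lemma S_abs: "\<sigma> \<in> S \<Longrightarrow> \<bar>\<sigma>\<bar> = 1"
  using S(2) by auto

lemma finite_S: "finite S"
  using S(2) finite_subset by blast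

lemma S_scale: "\<sigma> \<in> S \<Longrightarrow> p \<in> \<Omega> \<Longrightarrow> \<sigma> *\<^sub>R p \<in> \<Omega>"
  using S(2) S_neg by (auto simp: \<Omega>)

lemma S_even: "\<sigma> \<in> S \<Longrightarrow> r (\<sigma> * s) = r s"
  using S(2) r_even by auto

lemma \<pi>_scale: "\<sigma> \<in> S \<Longrightarrow> p \<in> \<Omega> \<Longrightarrow> \<pi> (\<sigma> *\<^sub>R p) = \<pi> p"
  using \<pi>_eq[of p "\<sigma> *\<^sub>R p"] S_scale[of \<sigma> p] by fastforce

lemma cap_subset: "p \<in> cap u c \<Omega> \<Longrightarrow> p \<in> \<Omega>"
  by (simp add: cap_def)

text \<open>If - 1 is in \<open>S\<close>, then c = 0, and an open hemisphere contains no antipodal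
  pair.\<close>

lemma inj_on_cap: "inj_on \<pi> (cap u c \<Omega>)"
proof (rule inj_onI)
  fix p q assume *: "p \<in> cap u c \<Omega>" "q \<in> cap u c \<Omega>" "\<pi> p = \<pi> q"
  then obtain \<sigma> where "\<sigma> \<in> S" "q = \<sigma> *\<^sub>R p" using \<pi>_eq cap_subset by blast
  then show "p = q" using * S(2) S_neg by (auto simp: cap_def)
qed

lemma inj_on_chart: "norm u = 1 \<Longrightarrow> inj_on (\<lambda>x. \<pi> (stereo_par u x)) (stereo_par u -` cap u c \<Omega>)"
  using inj_onD[OF inj_on_cap[of u]] injD[OF inj_stereo_par[of u]] by (auto intro!: inj_onI)

lemma compact_\<Omega>: "compact \<Omega>"
  by (auto simp: \<Omega> intro: compact_Times)

text \<open>\<open>S\<close> is finite and acts by isometries, so \<open>q\<close> has a positive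
  distance e from the orbit of \<open>p\<close>. Balls of radius e / 2 then have disjoint images,
  which are open because \<pi> is an open map.\<close>

lemma Hausdorff: "Hausdorff_space (mtop X)"
  unfolding Hausdorff_space_def
proof (intro allI impI, elim conjE)
  fix P Q assume "P \<in> topspace (mtop X)" "Q \<in> topspace (mtop X)" "P \<noteq> Q"
  then obtain p q where pq: "p \<in> \<Omega>" "q \<in> \<Omega>" "P = \<pi> p" "Q = \<pi> q"
    unfolding surj[symmetric] by blast
  define e where "e = Min ((\<lambda>\<sigma>. dist (\<sigma> *\<^sub>R p) q) ` S)"
  have e_le: "e \<le> dist (\<sigma> *\<^sub>R p) q" if "\<sigma> \<in> S" for \<sigma>
    unfolding e_def using that finite_S by auto
  have "e \<in> (\<lambda>\<sigma>. dist (\<sigma> *\<^sub>R p) q) ` S"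
    unfolding e_def using S(1) finite_S by (intro Min_in) auto
  moreover have "q \<noteq> \<sigma> *\<^sub>R p" if "\<sigma> \<in> S" for \<sigma>
    using that pq \<open>P \<noteq> Q\<close> \<pi>_eq by blast
  then have "dist (\<sigma> *\<^sub>R p) q > 0" if "\<sigma> \<in> S" for \<sigma>
    using that by (metis zero_less_dist_iff)
  ultimately have e: "e > 0" by blast
  define U where "U p = \<pi> ` (\<Omega> \<inter> ball p (e / 2))" for p
  have U: "openin (mtop X) (U p)" for p
    using opn unfolding open_map_def U_def by (simp add: openin_open_Int)
  have "disjnt (U p) (U q)"
    unfolding disjnt_iff
  proof (intro allI notI, elim conjE)
    fix Z assume "Z \<in> U p" "Z \<in> U q"
    then obtain p' q' where *: "p' \<in> \<Omega>" "dist p p' < e / 2" "q' \<in> \<Omega>" "dist q q' < e / 2" "\<pi> p' = \<pi> q'"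
      by (auto simp: U_def)
    then obtain \<sigma> where \<sigma>: "\<sigma> \<in> S" "q' = \<sigma> *\<^sub>R p'" using \<pi>_eq by blast
    have "dist (\<sigma> *\<^sub>R p) (\<sigma> *\<^sub>R p') = \<bar>\<sigma>\<bar> * dist p p'"
      by (simp add: dist_norm flip: scaleR_diff_right)
    then have "dist (\<sigma> *\<^sub>R p) q < e"
      using * S_abs[OF \<sigma>(1)] dist_triangle[of "\<sigma> *\<^sub>R p" q q'] by (simp add: \<sigma>(2) dist_commute)
    then show False using e_le[OF \<sigma>(1)] by simp
  qed
  moreover have "P \<in> U p" "Q \<in> U q" using pq e by (auto simp: U_def)
  ultimately show "\<exists>U V. openin (mtop X) U \<and> openin (mtop X) V \<and> P \<in> U \<and> Q \<in> V \<and> disjnt U V"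
    using U by blast
qed

lemma compact_mtop: "compact_space (mtop X)"
proof -
  have "compactin (top_of_set \<Omega>) \<Omega>"
    using compact_\<Omega> by (simp add: compactin_subtopology)
  from image_compactin[OF this cont] show ?thesis by (simp add: compact_space_def surj)
qed

lemma second_countable_mtop: "second_countable (mtop X)"
proof -
  have "second_countable (top_of_set \<Omega>)"
    by (intro second_countable_subtopology second_countable_euclidean)
  then show ?thesis
    by (rule second_countable_open_map_image[OF cont opn, rotated]) (simp add: surj)
qed

lemma half_space_like_chart: "norm u = 1 \<Longrightarrow> half_space_like (stereo_par u -` cap u c \<Omega>)"
  unfolding \<Omega> by (rule half_space_like_stereo_slab(1)[OF _ \<alpha>\<beta>])

lemma chart_image: "norm u = 1 \<Longrightarrow> (\<lambda>x. \<pi> (stereo_par u x)) ` (stereo_par u -` cap u c \<Omega>) = \<pi> ` cap u c \<Omega>"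
  using stereo_par_image_cap[OF _ c(2) \<Omega>_subset, of u] by (metis image_image)

lemma chart: "norm u = 1 \<Longrightarrow> riemannian_chart (mtop X) (C u)"
proof -
  assume u: "norm u = 1"
  have cm: "continuous_map (top_of_set (stereo_par u -` cap u c \<Omega>)) (mtop X) (\<pi> \<circ> stereo_par u)"
    by (rule continuous_map_compose[OF continuous_map_stereo_par[OF u c(2) \<Omega>_subset] cont])
  have om: "open_map (top_of_set (stereo_par u -` cap u c \<Omega>)) (mtop X) (\<pi> \<circ> stereo_par u)"
    by (rule open_map_compose[OF open_map_stereo_par[OF u c(2) \<Omega>_subset] opn])
  show ?thesis
  proof (rule riemannian_chartI[OF u])
    show "embedding_map (top_of_set (cdom (C u))) (mtop X) (cpar (C u))"
      using injective_open_imp_embedding_map[OF cm om] inj_on_chart[OF u] by (simp add: comp_def)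
    show "openin (mtop X) (cpar (C u) ` cdom (C u))"
      using om by (simp add: open_map_def comp_def)
  qed (use Ck_on_r_r1 r_pos half_space_like_chart[OF u] in auto)
qed

lemma compatible:
  assumes u: "norm u = 1" and w: "norm w = 1"
  shows "compatible_charts (C u) (C w)"
proof (rule compatible_chartsI[OF u w C_simps(3) C_simps(3)])
  \<comment> \<open>The region where \<sigma> carries a point of the chart into the cap of
    \<open>w\<close>; there the coordinate change is
    \<open>stereo_trans \<sigma> u w\<close>.\<close>
  define W where "W \<sigma> = {y. \<sigma> * (snd (stereo_par u y) \<bullet> w) < c}" for \<sigma>
  have W: "open (W \<sigma>)" for \<sigma>
    unfolding W_def by (intro open_Collect_less continuous_intros continuous_on_stereo_par)
  have W_cap: "\<sigma> *\<^sub>R stereo_par u y \<in> cap w c \<Omega>" if "\<sigma> \<in> S" "y \<in> W \<sigma>" "stereo_par u y \<in> cap u c \<Omega>" for y \<sigma>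
    using that(2) S_scale[OF that(1) cap_subset[OF that(3)]] by (simp add: cap_def W_def)
  have ov: "overlap (C u) (C w) = (stereo_par u -` cap u c \<Omega>) \<inter> (\<Union>\<sigma>\<in>S. W \<sigma>)"
  proof (intro set_eqI iffI)
    fix y assume "y \<in> overlap (C u) (C w)"
    then obtain q where y: "stereo_par u y \<in> cap u c \<Omega>" and q: "q \<in> cap w c \<Omega>" "\<pi> (stereo_par u y) = \<pi> q"
      unfolding overlap_def by auto
    then obtain \<sigma> where "\<sigma> \<in> S" "q = \<sigma> *\<^sub>R stereo_par u y" using \<pi>_eq cap_subset by blast
    then show "y \<in> (stereo_par u -` cap u c \<Omega>) \<inter> (\<Union>\<sigma>\<in>S. W \<sigma>)"
      using y q by (auto simp: W_def cap_def)
  next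
    fix y assume "y \<in> (stereo_par u -` cap u c \<Omega>) \<inter> (\<Union>\<sigma>\<in>S. W \<sigma>)"
    then obtain \<sigma> where y: "stereo_par u y \<in> cap u c \<Omega>" "\<sigma> \<in> S" "y \<in> W \<sigma>" by blast
    then have "\<pi> (stereo_par u y) \<in> \<pi> ` cap w c \<Omega>"
      using W_cap[OF y(2,3,1)] \<pi>_scale[OF y(2) cap_subset[OF y(1)]] by (metis imageI)
    then show "y \<in> overlap (C u) (C w)"
      using y(1) by (simp add: overlap_def chart_image[OF w])
  qed
  show "half_space_like (overlap (C u) (C w))"
    unfolding ov using W by (intro half_space_like_Int_open half_space_like_chart u) auto
  fix x assume "x \<in> overlap (C u) (C w)"
  then obtain \<sigma> where \<sigma>: "\<sigma> \<in> S" "x \<in> W \<sigma>" unfolding ov by blast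
  have dom: "W \<sigma> \<subseteq> trans_dom u w \<sigma>"
    using c(2) by (auto simp: W_def trans_dom_def[OF u w S_abs[OF \<sigma>(1)]])
  have "transition (C u) (C w) y = stereo_trans \<sigma> u w y" if "y \<in> W \<sigma> \<inter> overlap (C u) (C w)" for y
  proof -
    have y: "stereo_par u y \<in> cap u c \<Omega>" "y \<in> W \<sigma>" using that by (auto simp: ov)
    have *: "stereo_par w (stereo_trans \<sigma> u w y) = \<sigma> *\<^sub>R stereo_par u y"
      using stereo_par_stereo_trans[OF u w S_abs[OF \<sigma>(1)]] dom y(2) by blast
    show ?thesis
      unfolding transition_def
    proof (rule inv_into_f_eq)
      show "inj_on (cpar (C w)) (cdom (C w))" using inj_on_chart[OF w] by simp
      show "stereo_trans \<sigma> u w y \<in> cdom (C w)"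
        using W_cap[OF \<sigma>(1) y(2,1)] by (simp add: *)
      show "cpar (C w) (stereo_trans \<sigma> u w y) = cpar (C u) y"
        using \<pi>_scale[OF \<sigma>(1) cap_subset[OF y(1)]] by (simp add: *)
    qed
  qed
  then show "\<exists>\<sigma> U. \<bar>\<sigma>\<bar> = 1 \<and> (\<forall>s. r (\<sigma> * s) = r s) \<and> open U \<and> x \<in> U \<and> U \<subseteq> trans_dom u w \<sigma>
        \<and> (\<forall>y\<in>U \<inter> overlap (C u) (C w). transition (C u) (C w) y = stereo_trans \<sigma> u w y)"
    using \<sigma> W dom S_abs[OF \<sigma>(1)] S_even[OF \<sigma>(1)] by blast
qed

lemma riemannian: "riemannian_manifold X"
proof -
  have "(\<Union>ch\<in>atlas X. cpar ch ` cdom ch) = (\<Union>u\<in>sphere 0 1. \<pi> ` cap u c \<Omega>)"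
    by (simp add: atlas_eq chart_image)
  also have "\<dots> = \<pi> ` \<Omega>"
  proof -
    \<comment> \<open>With the pole opposite to the point the inner product is - 1, which is below
      \<open>c\<close>.\<close>
    have "p \<in> cap (- snd p) c \<Omega> \<and> - snd p \<in> sphere 0 1" if "p \<in> \<Omega>" for p
      using that c(1) by (auto simp: cap_def \<Omega> norm_eq_1)
    then show ?thesis using cap_subset by blast
  qed
  finally have "(\<Union>ch\<in>atlas X. cpar ch ` cdom ch) = topspace (mtop X)" by (simp add: surj)
  then show ?thesis
    unfolding riemannian_manifold_def
    using Hausdorff second_countable_mtop chart compatible by (auto simp: atlas_eq)
qed

lemma critical:
  assumes l: "lam c0 \<alpha> = 0" "lam c0 \<beta> = 0" and c0: "-1 \<in> S \<Longrightarrow> c0 = 0"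
  shows "critical_metric X"
proof -
  \<comment> \<open>The choice of the representative does not matter: only the sign - 1 changes the
    height, and then c0 = 0 and \<open>lam 0\<close> is even.\<close>
  define f where "f P = lam c0 (fst (SOME p. p \<in> \<Omega> \<and> \<pi> p = P))" for P
  have f_\<pi>: "f (\<pi> p) = lam c0 (fst p)" if p: "p \<in> \<Omega>" for p
  proof -
    define q where "q = (SOME q. q \<in> \<Omega> \<and> \<pi> q = \<pi> p)"
    have q: "q \<in> \<Omega> \<and> \<pi> q = \<pi> p" unfolding q_def by (rule someI[of _ p]) (use p in simp)
    then obtain \<sigma> where "\<sigma> \<in> S" "q = \<sigma> *\<^sub>R p" using \<pi>_eq[OF p, of q] by metis
    then have "lam c0 (fst q) = lam c0 (fst p)" using S(2) c0 lam_even by auto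
    then show ?thesis by (simp add: f_def q_def)
  qed
  have f_chart: "(f \<circ> cpar (C u)) x = lam c0 (x \<bullet> u)" if "x \<in> cdom (C u)" for u x
    using that by (simp add: f_\<pi> cap_subset)
  have "smooth_function X f"
    unfolding smooth_function_def atlas_eq
  proof (intro ballI, elim imageE, simp only:)
    fix u
    show "smooth_on (cdom (C u)) (f \<circ> cpar (C u))"
      by (rule smooth_onI[OF open_UNIV _ Ck_on_compose_real[OF open_UNIV Ck_on_lam Ck_on_height]])
         (use f_chart in auto)
  qed
  moreover have "\<forall>p\<in>manifold_boundary X. f p = 0"
  proof
    fix p assume "p \<in> manifold_boundary X"
    then obtain u x where u: "norm u = 1" "p = cpar (C u) x" and x: "x \<in> cdom (C u) - interior (cdom (C u))"
      unfolding manifold_boundary_def atlas_eq by (elim UN_E imageE) (metis mem_sphere_0)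
    \<comment> \<open>Only the end slices can be boundary. In the antipodal quotient the horizon
      lies inside the symmetric slab.\<close>
    have "x \<bullet> u = \<alpha> \<or> x \<bullet> u = \<beta>"
      using half_space_like_stereo_slab(2)[OF u(1) \<alpha>\<beta>, of c, folded \<Omega>] x by auto
    then show "f p = 0" using f_chart[of x u] x l u(2) by auto
  qed
  moreover have "critical_equation X f"
    unfolding critical_equation_def atlas_eq
  proof (intro ballI allI, elim imageE)
    fix ch x v w u assume "x \<in> cdom ch" "ch = C u" "u \<in> sphere 0 1"
    then show "- laplacian (cdom ch) (cmet ch) (f \<circ> cpar ch) x * cmet ch x v w
       + hessian (cdom ch) (cmet ch) (f \<circ> cpar ch) x v w
       - f (cpar ch x) * ricci (cdom ch) (cmet ch) x v w = cmet ch x v w"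
      using critical_equation_stereo[OF n_eq, of u "cdom ch" "f \<circ> cpar ch" c0 x v w]
        half_space_like_chart[of u] f_chart[of _ u] by (simp del: comp_apply) (simp add: comp_def)
  qed
  ultimately show ?thesis
    unfolding critical_metric_def using riemannian compact_mtop by blast
qed

end

section \<open>The closed domain and the antipodal quotient as slab quotients\<close>

lemma (in schwarzschild_radial) critical_subdomain:
  assumes "n = DIM('a::euclidean_space)" "\<alpha> < \<beta>" "lam c0 \<alpha> = 0" "lam c0 \<beta> = 0"
  shows "critical_metric (subdomain (schwarzschild r :: ('a, real \<times> 'a) rmanifold) ({\<alpha>..\<beta>} \<times> sphere 0 1))"
proof -
  define \<Omega> where "\<Omega> = {\<alpha>..\<beta>} \<times> (sphere 0 1 :: 'a set)"
  define X where "X = subdomain (schwarzschild r :: ('a, real \<times> 'a) rmanifold) \<Omega>"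
  have top: "mtop X = top_of_set \<Omega>"
    by (auto simp: X_def subdomain_def schwarzschild_def schwarzschild_space_def \<Omega>_def subtopology_subtopology
        intro!: arg_cong[of _ _ top_of_set])
  have "(\<lambda>c. c\<lparr>cdom := {x \<in> cdom c. cpar c x \<in> \<Omega>}\<rparr>) (stereo_chart r u)
    = \<lparr>cdom = stereo_par u -` cap u 1 \<Omega>, cpar = (\<lambda>x. id (stereo_par u x)), cmet = cmet (stereo_chart r u)\<rparr>"
    if "u \<in> sphere 0 1" for u
    using snd_stereo_par_pole_less[of u] that by (auto simp: stereo_chart_def cap_def)
  then have atl: "atlas X = (\<lambda>u. \<lparr>cdom = stereo_par u -` cap u 1 \<Omega>, cpar = (\<lambda>x. id (stereo_par u x)),
        cmet = cmet (stereo_chart r u)\<rparr>) ` sphere 0 1"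
    by (simp add: X_def subdomain_def schwarzschild_def image_image cong: image_cong_simp)
  interpret slab_quotient n a r \<alpha> \<beta> 1 "{1}" id X \<Omega>
    by unfold_locales (use assms atl in \<open>auto simp: top \<Omega>_def open_map_def\<close>)
  show ?thesis using critical[OF assms(3,4)] by (simp add: X_def \<Omega>_def)
qed


lemma mem_uminus_image: "x \<in> uminus ` A \<longleftrightarrow> - x \<in> A" for x :: "'a::group_add"
  by (metis imageE imageI minus_minus)

text \<open>The quotient is built from \<open>H\<close>, one half of the symmetric slab
  \<open>\<Omega>\<close>, and is recognised here as \<open>\<Omega>\<close> modulo p \<mapsto> - p:
  every orbit meets \<open>H\<close>, and it does so twice only at the horizon. The absolute value
  of \<theta> covers both sides on which \<open>H\<close> may lie.\<close>

lemma (in schwarzschild_radial) critical_antipodal_quotient: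
  assumes "n = DIM('a::euclidean_space)" "\<theta> \<noteq> 0" "lam 0 \<theta> = 0"
  shows "critical_metric (antipodal_quotient r (domain_between 0 \<theta> :: (real \<times> 'a) set))"
proof -
  define H :: "(real \<times> 'a) set" where "H = domain_between 0 \<theta>"
  define \<Omega> where "\<Omega> = {- \<bar>\<theta>\<bar>..\<bar>\<theta>\<bar>} \<times> (sphere 0 1 :: 'a set)"
  define X where "X = antipodal_quotient r H"
  define \<pi> where "\<pi> p = antipodal_class (if p \<in> H then p else - p)" for p :: "real \<times> 'a"
  have H: "p \<in> H \<longleftrightarrow> fst p \<in> closed_segment 0 \<theta> \<and> norm (snd p) = 1" for p
    by (auto simp: H_def domain_between_def mem_Times_iff)
  have \<Omega>_H: "p \<in> \<Omega> \<longleftrightarrow> p \<in> H \<or> - p \<in> H" for p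
    unfolding H \<Omega>_def by (auto simp: closed_segment_eq_real_ivl mem_Times_iff)
  have H_minus: "- p \<in> H \<longleftrightarrow> fst p = 0" if "p \<in> H" for p
    using that unfolding H by (auto simp: closed_segment_eq_real_ivl split: if_splits)
  have minus0: "- p = (0, - snd p)" if "fst p = 0" for p :: "real \<times> 'a"
    using that by (simp add: prod_eq_iff)
  have class_minus: "antipodal_class (- p) = antipodal_class p" if "fst p = 0" for p :: "real \<times> 'a"
    using that minus0[OF that] by (auto simp: antipodal_class_def prod_eq_iff)
  have \<pi>_H: "\<pi> p = antipodal_class p" if "p \<in> H" for p
    using that by (simp add: \<pi>_def)
  have \<pi>_minus: "\<pi> (- p) = \<pi> p" if "p \<in> \<Omega>" for p
    using that class_minus[of p] H_minus[of p] H_minus[of "- p"] unfolding \<Omega>_H \<pi>_def by auto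
  have \<pi>_sub: "\<pi> p \<noteq> {} \<and> \<pi> p \<subseteq> {p, - p}" for p
    by (auto simp: \<pi>_def antipodal_class_def prod_eq_iff)
  have \<pi>_iff: "\<pi> p = \<pi> q \<longleftrightarrow> q = p \<or> q = - p" if "p \<in> \<Omega>" for p q
  proof
    assume "\<pi> p = \<pi> q"
    then obtain z where "z \<in> {p, - p}" "z \<in> {q, - q}" using \<pi>_sub[of p] \<pi>_sub[of q] by blast
    then show "q = p \<or> q = - p" by (auto simp: minus_equation_iff)
  qed (use \<pi>_minus[OF that] in auto)
  have top: "mtop X = quotient_topology (top_of_set H) antipodal_class"
    by (simp add: X_def antipodal_quotient_def)
  have closed_H: "closed H"
    unfolding H_def domain_between_def by (intro closed_Times closed_segment) simp
  have im: "\<pi> ` \<Omega> = antipodal_class ` H"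
  proof -
    have "\<pi> p \<in> antipodal_class ` H" if "p \<in> \<Omega>" for p
      using that \<pi>_minus[OF that] \<pi>_H unfolding \<Omega>_H by (metis imageI)
    moreover have "antipodal_class p \<in> \<pi> ` \<Omega>" if "p \<in> H" for p
      using that \<pi>_H[OF that] \<Omega>_H[of p] by (metis imageI)
    ultimately show ?thesis by blast
  qed
  have cont: "continuous_map (top_of_set \<Omega>) (mtop X) \<pi>"
    unfolding continuous_map_def top
  proof (intro conjI allI impI)
    show "\<pi> \<in> topspace (top_of_set \<Omega>) \<rightarrow> topspace (quotient_topology (top_of_set H) antipodal_class)"
      using im by (auto simp: topspace_quotient_topology)
    fix U assume "openin (quotient_topology (top_of_set H) antipodal_class) U"
    then have U: "openin (top_of_set H) {x \<in> H. antipodal_class x \<in> U}"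
      by (simp add: openin_quotient_topology)
    \<comment> \<open>Continuity is checked on closed sets: \<open>H\<close> is closed, so
      \<open>K\<close> is closed in the whole space, and the preimage in \<open>\<Omega>\<close>
      omits just \<open>K\<close> and its mirror image.\<close>
    define K where "K = H - {x \<in> H. antipodal_class x \<in> U}"
    have "closedin (top_of_set H) K"
      unfolding K_def using U by (intro closedin_diff) auto
    then have K: "closed K"
      using closed_H closedin_closed_trans by blast
    have K_iff: "x \<in> K \<longleftrightarrow> x \<in> H \<and> \<pi> x \<notin> U" for x
      by (cases "x \<in> H") (simp_all add: K_def \<pi>_H)
    have "\<pi> x \<in> U \<longleftrightarrow> x \<in> - (K \<union> uminus ` K)" if "x \<in> \<Omega>" for x
      using \<pi>_minus[OF that] \<Omega>_H[of x] that
      unfolding Compl_iff Un_iff mem_uminus_image K_iff by metis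
    then have "{x \<in> topspace (top_of_set \<Omega>). \<pi> x \<in> U} = \<Omega> \<inter> - (K \<union> uminus ` K)"
      unfolding topspace_euclidean_subtopology by blast
    moreover have "open (- (K \<union> uminus ` K))"
      using K by (intro open_Compl closed_Un closed_negations)
    ultimately show "openin (top_of_set \<Omega>) {x \<in> topspace (top_of_set \<Omega>). \<pi> x \<in> U}"
      by (simp add: openin_open_Int)
  qed
  have opn: "open_map (top_of_set \<Omega>) (mtop X) \<pi>"
    unfolding open_map_def top openin_quotient_topology
  proof (intro allI impI conjI)
    fix V assume "openin (top_of_set \<Omega>) V"
    then obtain T where T: "open T" "V = \<Omega> \<inter> T" by (auto simp: openin_open)
    show "\<pi> ` V \<subseteq> antipodal_class ` topspace (top_of_set H)" using im T by auto
    \<comment> \<open>A class lies in the image of \<open>V\<close> as soon as one of x, - x lies in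
      \<open>T\<close>; symmetrising \<open>T\<close> gives openness across the horizon too.\<close>
    have "{x \<in> topspace (top_of_set H). antipodal_class x \<in> \<pi> ` V} = H \<inter> (T \<union> uminus ` T)"
    proof -
      have "antipodal_class x \<in> \<pi> ` V \<longleftrightarrow> x \<in> T \<or> - x \<in> T" if "x \<in> H" for x
      proof -
        have x: "x \<in> \<Omega>" "- x \<in> \<Omega>" using that \<Omega>_H by auto
        have "antipodal_class x \<in> \<pi> ` V \<longleftrightarrow> (\<exists>v\<in>V. v = x \<or> v = - x)"
          using \<pi>_iff[OF x(1)] \<pi>_H[OF that] by (auto simp: image_iff)
        then show ?thesis using x T(2) by auto
      qed
      then have "antipodal_class x \<in> \<pi> ` V \<longleftrightarrow> x \<in> T \<union> uminus ` T" if "x \<in> H" for x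
        unfolding Un_iff mem_uminus_image using that by blast
      then show ?thesis unfolding topspace_euclidean_subtopology by blast
    qed
    then show "openin (top_of_set H) {x \<in> topspace (top_of_set H). antipodal_class x \<in> \<pi> ` V}"
      using T(1) by (simp add: openin_open_Int open_Un open_negations)
  qed
  have "quotient_chart H r u = \<lparr>cdom = stereo_par u -` cap u 0 \<Omega>, cpar = (\<lambda>x. \<pi> (stereo_par u x)),
        cmet = cmet (stereo_chart r u)\<rparr>" for u
  proof -
    have "p \<in> H \<union> uminus ` H \<longleftrightarrow> p \<in> \<Omega>" for p
      unfolding \<Omega>_H Un_iff mem_uminus_image ..
    then show ?thesis by (auto simp: quotient_chart_def cap_def Let_def \<pi>_def)
  qed
  then have atl: "atlas X = (\<lambda>u. \<lparr>cdom = stereo_par u -` cap u 0 \<Omega>, cpar = (\<lambda>x. \<pi> (stereo_par u x)),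
        cmet = cmet (stereo_chart r u)\<rparr>) ` sphere 0 1"
    by (simp add: X_def antipodal_quotient_def)
  interpret slab_quotient n a r "- \<bar>\<theta>\<bar>" "\<bar>\<theta>\<bar>" 0 "{1, -1}" \<pi> X \<Omega>
    by unfold_locales
       (use assms atl cont opn im \<pi>_iff in \<open>auto simp: top topspace_quotient_topology \<Omega>_def[symmetric]\<close>)
  have "lam 0 \<bar>\<theta>\<bar> = 0" using assms(3) lam_even[of \<theta>] by (simp add: abs_if)
  then have "critical_metric X" using lam_even[of "\<bar>\<theta>\<bar>"] by (intro critical[of 0]) auto
  then show ?thesis by (simp add: X_def H_def)
qed

section \<open>The two sides of the horizon\<close>

text \<open>The segment condition says that 0 separates \<open>A\<close> from \<open>B\<close>. A
  connected set containing \<open>A \<times> T\<close> projects to an interval that meets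
  \<open>A\<close> and avoids 0, hence misses \<open>B\<close>.\<close>

lemma mem_components_half:
  fixes A B :: "real set"
  assumes "connected (T :: 'b::metric_space set)" "T \<noteq> {}" "connected A" "A \<noteq> {}"
    and "\<And>x y. x \<in> A \<Longrightarrow> y \<in> B \<Longrightarrow> 0 \<in> closed_segment x y" "0 \<notin> A" "0 \<notin> B"
  shows "A \<times> T \<in> components ((A \<union> B) \<times> T)"
  unfolding in_components_maximal
proof (intro conjI allI impI)
  fix D assume D: "D \<noteq> {} \<and> A \<times> T \<subseteq> D \<and> D \<subseteq> (A \<union> B) \<times> T \<and> connected D"
  have "connected (fst ` D)"
    using D by (intro connected_continuous_image continuous_intros) auto
  then have seg: "closed_segment x y \<subseteq> fst ` D" if "x \<in> fst ` D" "y \<in> fst ` D" for x y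
    using that by (meson closed_segment_subset connected_convex_1)
  have "0 \<notin> fst ` D" using D assms(6,7) by auto
  have "fst p \<in> A" if "p \<in> D" for p
  proof (rule ccontr)
    assume "fst p \<notin> A"
    then have "fst p \<in> B" using D that by auto
    moreover obtain x t where "x \<in> A" "t \<in> T" using assms by blast
    moreover have "x \<in> fst ` D" using D calculation by force
    ultimately show False using assms(5) seg[of x "fst p"] that \<open>0 \<notin> fst ` D\<close> by blast
  qed
  then show "D = A \<times> T" using D by auto
qed (use assms in \<open>auto intro: connected_Times\<close>)

lemma components_minus_horizon:
  assumes "DIM('a::euclidean_space) \<ge> 2"
  shows "{0<..} \<times> sphere 0 1 \<in> components (schwarzschild_space - horizon :: (real \<times> 'a) set)"
    and "{..<0} \<times> sphere 0 1 \<in> components (schwarzschild_space - horizon :: (real \<times> 'a) set)"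
proof -
  have T: "connected (sphere (0::'a) 1)" "sphere (0::'a) 1 \<noteq> {}"
    using assms by (simp_all add: connected_sphere)
  have eq: "schwarzschild_space - horizon = ({0<..} \<union> {..<0}) \<times> sphere (0::'a) 1"
    "schwarzschild_space - horizon = ({..<0} \<union> {0<..}) \<times> sphere (0::'a) 1"
    by (auto simp: schwarzschild_space_def slice_def)
  show "{0<..} \<times> sphere 0 1 \<in> components (schwarzschild_space - horizon :: (real \<times> 'a) set)"
    unfolding eq(1) using T by (rule mem_components_half) (auto simp: closed_segment_eq_real_ivl)
  show "{..<0} \<times> sphere 0 1 \<in> components (schwarzschild_space - horizon :: (real \<times> 'a) set)"
    unfolding eq(2) using T by (rule mem_components_half) (auto simp: closed_segment_eq_real_ivl)
qed

theorem corollary3p1: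
  fixes a :: real
    and r :: "real \<Rightarrow> real"
    and M_plus M_minus :: "(real \<times> 'a::euclidean_space) set"
  assumes "DIM('a) \<ge> 3"
    and "schwarzschild_profile DIM('a) a r"
    and "components (schwarzschild_space - horizon) = {M_plus, M_minus}"
    and "M_plus \<noteq> M_minus"
  shows "(\<exists>f. smooth_function (schwarzschild r :: ('a, real \<times> 'a) rmanifold) f \<and>
              critical_equation (schwarzschild r :: ('a, real \<times> 'a) rmanifold) f)
       \<and> (\<forall>\<zeta>1. slice \<zeta>1 \<subseteq> M_plus \<longrightarrow>
            (\<exists>\<zeta>2. slice \<zeta>2 \<subseteq> M_minus \<and>
               critical_metric
                 (subdomain (schwarzschild r :: ('a, real \<times> 'a) rmanifold)
                   (domain_between \<zeta>1 \<zeta>2))))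
       \<and> (\<exists>\<theta>. slice \<theta> \<subseteq> M_plus \<and>
            critical_metric
              (antipodal_quotient r (domain_between 0 \<theta> :: (real \<times> 'a) set)))"
proof -
  interpret schwarzschild_radial "DIM('a)" a r
    using assms by unfold_locales
  let ?P = "{0::real<..} \<times> sphere (0::'a) 1" and ?N = "{..<0::real} \<times> sphere (0::'a) 1"
  have "(1, SOME i. i \<in> Basis) \<in> ?P" "(1, SOME i. i \<in> Basis) \<notin> ?N" by (simp_all add: some_in_eq)
  then have "?P \<noteq> ?N" by metis
  moreover have "?P \<in> {M_plus, M_minus}" "?N \<in> {M_plus, M_minus}"
    using components_minus_horizon[where 'a='a] assms(1) unfolding assms(3) by auto
  \<comment> \<open>The hypotheses do not say which component is which, so both placements
    remain.\<close>
  ultimately have sides: "M_plus = ?P \<and> M_minus = ?N \<or> M_plus = ?N \<and> M_minus = ?P"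
    by auto
  have slice: "slice \<zeta> \<subseteq> A \<times> sphere (0::'a) 1 \<longleftrightarrow> \<zeta> \<in> A" for \<zeta> A
    by (simp add: slice_def times_subset_iff)
  have dom: "domain_between \<zeta>1 \<zeta>2 = {min \<zeta>1 \<zeta>2..max \<zeta>1 \<zeta>2} \<times> sphere (0::'a) 1" for \<zeta>1 \<zeta>2
    by (auto simp: domain_between_def closed_segment_eq_real_ivl)
  have ii: "critical_metric (subdomain (schwarzschild r :: ('a, real \<times> 'a) rmanifold) (domain_between \<zeta>1 \<zeta>2))"
    if "\<zeta>1 \<noteq> \<zeta>2" "lam c \<zeta>1 = 0" "lam c \<zeta>2 = 0" for c \<zeta>1 \<zeta>2
    unfolding dom using that by (intro critical_subdomain[of _ _ c]) (auto simp: min_def max_def)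
  have "\<exists>\<zeta>2. slice \<zeta>2 \<subseteq> M_minus \<and>
      critical_metric (subdomain (schwarzschild r :: ('a, real \<times> 'a) rmanifold) (domain_between \<zeta>1 \<zeta>2))"
    if \<zeta>1: "slice \<zeta>1 \<subseteq> M_plus" for \<zeta>1
  proof -
    have "\<zeta>1 \<noteq> 0" using sides \<zeta>1 slice by auto
    then obtain c where c: "lam c \<zeta>1 = 0" using lam_prescribed_zero by blast
    from sides show ?thesis
    proof (elim disjE conjE)
      assume M: "M_plus = ?P" "M_minus = ?N"
      obtain s where "s < 0" "lam c s = 0" using lam_zero_neg by blast
      then show ?thesis
        using ii[OF _ c, of s] \<zeta>1 unfolding M slice by (intro exI[of _ s]) auto
    next
      assume M: "M_plus = ?N" "M_minus = ?P"
      obtain s where "s > 0" "lam c s = 0" using lam_zero_pos by blast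
      then show ?thesis
        using ii[OF _ c, of s] \<zeta>1 unfolding M slice by (intro exI[of _ s]) auto
    qed
  qed
  moreover have "\<exists>\<theta>. slice \<theta> \<subseteq> M_plus \<and>
      critical_metric (antipodal_quotient r (domain_between 0 \<theta> :: (real \<times> 'a) set))"
  proof -
    obtain s where s: "s > 0" "lam 0 s = 0" using lam_zero_pos by blast
    \<comment> \<open>If \<open>M_plus\<close> is the negative side, the mirror image - s serves as
      \<theta>, since \<open>lam 0\<close> is even.\<close>
    then have "slice s \<subseteq> M_plus \<or> slice (- s) \<subseteq> M_plus"
      using sides slice[of s "{0<..}"] slice[of "- s" "{..<0}"] by fastforce
    then show ?thesis
      using s lam_even[of s] critical_antipodal_quotient[OF refl, of s]
        critical_antipodal_quotient[OF refl, of "- s"] by (metis less_irrefl neg_equal_0_iff_equal)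
  qed
  ultimately show ?thesis
    using critical_on_schwarzschild[OF refl] by blast
qed

end
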